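(* Let $G$ be a unicyclic graph of order $n$ with girth $g$ and matching number $\beta$. If $\beta\ge \frac{3g}{2}$, then $$W(G)\ge W(G^*_{(n,g,\beta)}),$$ with equality if and only if $G$ is isomorphic to $G^*_{(n,g,\beta)}$.
   Context: All graphs are finite, simple, undirected and connected. $d_G(u,v)$ is the distance between $u$ and $v$ in $G$, and the Wiener index is $W(G)=\sum_{\{u,v\}\subseteq V(G)} d_G(u,v)$. A unicyclic graph is a connected graph with exactly one cycle; its girth $g$ is the length of that cycle. The matching number $\beta(G)$ is the maximum size of a matching (set of pairwise vertex-disjoint edges) of $G$. For nonnegative integers $a,b$, $T^*_{a,b}$ is the rooted tree of order $2a+b+1$ obtained from the star $K_{1,a+b}$ with root its center by attaching one new pendant vertex to each of $a$ of its leaves ($T^*_{0,0}$ is a single vertex). The graph $G^*_{(n,g,\beta)}$ is defined as follows. If $g$ is odd, it is obtained from a cycle $C_g$ and the tree $T^*_{\beta-\frac{g+1}{2},\,n-2\beta+1}$ (of order $n-g+1$) by identifying a vertex of $C_g$ with the root of the tree. If $g$ is even, it is obtained from a cycle $C_g=u_1u_2\cdots u_g$ and the tree $T^*_{\beta-\frac g2-1,\,n-2\beta+1}$ (of order $n-g$) by identifying $u_1$ with the root of the tree, and then adding one new vertex $v$ and the pendant edge $u_2v$. (In both cases $G^*_{(n,g,\beta)}$ is a unicyclic graph of order $n$, girth $g$ and matching number $\beta$.) *)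

theory Defs
  imports Complex_Main
begin

record 'a ugraph =
  verts :: "'a set"
  edges :: "'a set set"

definition simple_graph :: "'a ugraph \<Rightarrow> bool" where
  "simple_graph G \<longleftrightarrow> finite (verts G) \<and> (\<forall>e\<in>edges G. e \<subseteq> verts G \<and> card e = 2)"

definition subgraph :: "'a ugraph \<Rightarrow> 'a ugraph \<Rightarrow> bool" where
  "subgraph H G \<longleftrightarrow> simple_graph H \<and> verts H \<subseteq> verts G \<and> edges H \<subseteq> edges G"

definition isomorphic :: "'a ugraph \<Rightarrow> 'b ugraph \<Rightarrow> bool" where
  "isomorphic G H \<longleftrightarrow>
     (\<exists>f. bij_betw f (verts G) (verts H) \<and>
          (\<forall>u\<in>verts G. \<forall>v\<in>verts G. {u, v} \<in> edges G \<longleftrightarrow> {f u, f v} \<in> edges H))"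

text \<open>A walk is the nonempty list of its vertices, so its length is one less than that
  of the list.\<close>

definition walk :: "'a ugraph \<Rightarrow> 'a \<Rightarrow> 'a list \<Rightarrow> 'a \<Rightarrow> bool" where
  "walk G u p v \<longleftrightarrow>
     p \<noteq> [] \<and> hd p = u \<and> last p = v \<and> set p \<subseteq> verts G \<and>
     successively (\<lambda>x y. {x, y} \<in> edges G) p"

definition connected_graph :: "'a ugraph \<Rightarrow> bool" where
  "connected_graph G \<longleftrightarrow>
     verts G \<noteq> {} \<and> (\<forall>u\<in>verts G. \<forall>v\<in>verts G. \<exists>p. walk G u p v)"

definition distance :: "'a ugraph \<Rightarrow> 'a \<Rightarrow> 'a \<Rightarrow> nat" where
  "distance G u v = (LEAST k. \<exists>p. walk G u p v \<and> length p = k + 1)"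

text \<open>The sum ranges over the unordered pairs of distinct vertices; the description is well
  defined because the distance is symmetric.\<close>

definition wiener :: "'a ugraph \<Rightarrow> nat" where
  "wiener G = (\<Sum>S | S \<subseteq> verts G \<and> card S = 2.
     THE d. \<exists>u v. S = {u, v} \<and> d = distance G u v)"

definition matching :: "'a ugraph \<Rightarrow> 'a set set \<Rightarrow> bool" where
  "matching G M \<longleftrightarrow> M \<subseteq> edges G \<and> pairwise disjnt M"

definition matching_number :: "'a ugraph \<Rightarrow> nat" where
  "matching_number G = Max {card M | M. matching G M}"

definition cycle_graph :: "nat \<Rightarrow> nat ugraph" where
  "cycle_graph k = \<lparr> verts = {..<k}, edges = (\<lambda>i. {i, (i + 1) mod k}) ` {..<k} \<rparr>"

definition is_cycle :: "'a ugraph \<Rightarrow> 'a ugraph \<Rightarrow> bool" where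
  "is_cycle G C \<longleftrightarrow> subgraph C G \<and> (\<exists>k\<ge>3. isomorphic C (cycle_graph k))"

definition unicyclic :: "'a ugraph \<Rightarrow> bool" where
  "unicyclic G \<longleftrightarrow> simple_graph G \<and> connected_graph G \<and> (\<exists>!C. is_cycle G C)"

text \<open>Only meaningful when the cycle is unique, as in a unicyclic graph.\<close>

definition girth :: "'a ugraph \<Rightarrow> nat" where
  "girth G = card (edges (THE C. is_cycle G C))"

datatype tree_vertex = Root | Near nat | Far nat

text \<open>\<open>T_star a b\<close> is \<open>T\<^sup>*\<^sub>a\<^sub>,\<^sub>b\<close>, with root \<open>Root\<close>: the star has the leaves
  \<open>Near i\<close> for \<open>i < a + b\<close>, and the first \<open>a\<close> of them receive a pendant vertex.\<close>

definition T_star :: "nat \<Rightarrow> nat \<Rightarrow> tree_vertex ugraph" where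
  "T_star a b =
     \<lparr> verts = {Root} \<union> Near ` {..<a + b} \<union> Far ` {..<a},
       edges = (\<lambda>i. {Root, Near i}) ` {..<a + b} \<union> (\<lambda>i. {Near i, Far i}) ` {..<a} \<rparr>"

datatype g_vertex = Cyc nat | Tree tree_vertex | Extra

text \<open>Identifying the root with the cycle vertex \<open>Cyc 0\<close> amounts to sending it there and keeping
  the other tree vertices apart from the cycle.\<close>

definition glue :: "tree_vertex \<Rightarrow> g_vertex" where
  "glue t = (if t = Root then Cyc 0 else Tree t)"

definition cycle_with_tree :: "nat \<Rightarrow> tree_vertex ugraph \<Rightarrow> g_vertex ugraph" where
  "cycle_with_tree g T =
     \<lparr> verts = Cyc ` verts (cycle_graph g) \<union> glue ` verts T,
       edges = (image Cyc) ` edges (cycle_graph g) \<union> (image glue) ` edges T \<rparr>"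

text \<open>The vertices \<open>u\<^sub>1, u\<^sub>2, \<dots>, u\<^sub>g\<close> of the cycle are \<open>Cyc 0, Cyc 1, \<dots>, Cyc (g - 1)\<close>, and
  \<open>Extra\<close> is the additional pendant vertex \<open>v\<close> in the even case. The natural-number
  subtractions are the intended ones when \<open>g \<ge> 3\<close>, \<open>2 * \<beta> \<ge> 3 * g\<close> and \<open>2 * \<beta> \<le> n\<close>.\<close>

definition G_star :: "nat \<Rightarrow> nat \<Rightarrow> nat \<Rightarrow> g_vertex ugraph" where
  "G_star n g \<beta> =
     (if odd g then
        cycle_with_tree g (T_star (\<beta> - (g + 1) div 2) (n - 2 * \<beta> + 1))
      else
        (let H = cycle_with_tree g (T_star (\<beta> - g div 2 - 1) (n - 2 * \<beta> + 1))
         in \<lparr> verts = verts H \<union> {Extra}, edges = edges H \<union> {{Cyc 1, Extra}} \<rparr>))"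

end

theory Submission
  imports Defs
begin

text \<open>
  A unicyclic graph is its cycle together with a set \<open>T\<close> of \<open>N = n - g\<close> further vertices, each
  attached to a parent. Every \<open>z \<in> T\<close> gives a bridge, cutting off the \<open>s\<^sub>z\<close> descendants of \<open>z\<close>, and
  the distance of \<open>u\<close> and \<open>v\<close> is the number of bridges separating them plus the distance of their
  roots on the cycle. Hence \<open>2 W(G) = 2 \<Sum>\<^sub>z s\<^sub>z (n - s\<^sub>z) + Q + const\<close>, where \<open>Q\<close> sums the distances of
  the roots over all ordered pairs from \<open>T\<close> and the constant depends only on \<open>n\<close> and \<open>g\<close>.

  If \<open>L\<close> is the number of leaves, then \<open>\<Sum>\<^sub>z s\<^sub>z (n - s\<^sub>z) \<ge> 2 (n - 2) N - L (n - 3)\<close>, with equality iff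
  all \<open>s\<^sub>z \<le> 2\<close>. If \<open>m\<close> cycle vertices carry trees, then \<open>Q \<ge> (m - 1) (2 N - m)\<close>. Giving weight 2 to
  leaves and weight 1 to cycle vertices without a tree, every edge has weight at most 2, so a
  maximum matching yields \<open>2 L + g - m \<le> 2 n - 2 \<beta>\<close>. Since \<open>n \<ge> 2 \<beta> \<ge> 3 g\<close>, the gain in leaves from a
  larger \<open>m\<close> is outweighed by \<open>Q\<close>; the optimum is \<open>m = 1\<close> for odd and \<open>m = 2\<close> for even \<open>g\<close>, and
  equality determines the graph.
\<close>

section \<open>Walks and the Wiener index\<close>

lemma walk_Cons:
  "walk G u (x # p) v \<longleftrightarrow> x = u \<and> u \<in> verts G \<and>
     (if p = [] then u = v else {u, hd p} \<in> edges G \<and> walk G (hd p) p v)"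
  by (cases p) (auto simp: walk_def)

text \<open>A potential that vanishes at \<open>v\<close>, drops by at most one along every edge and
  by exactly one along some edge at each other vertex is the distance to \<open>v\<close>: following
  the exact drops gives a short walk, and no walk can be shorter. A closed formula for the distance
  can thus be verified locally.\<close>

lemma distance_eqI:
  fixes F :: "'a \<Rightarrow> nat"
  assumes u: "u \<in> verts G" and v: "v \<in> verts G"
    and F0: "F v = 0"
    and lip: "\<And>x y. {x, y} \<in> edges G \<Longrightarrow> x \<in> verts G \<Longrightarrow> y \<in> verts G \<Longrightarrow> F x \<le> Suc (F y)"
    and desc: "\<And>x. x \<in> verts G \<Longrightarrow> x \<noteq> v \<Longrightarrow> \<exists>y\<in>verts G. {x, y} \<in> edges G \<and> F x = Suc (F y)"
  shows "distance G u v = F u"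
proof -
  have ex: "\<exists>p. walk G x p v \<and> length p = F x + 1" if "x \<in> verts G" for x
    using that
  proof (induction "F x" arbitrary: x)
    case 0
    then have "x = v" using desc[of x] by force
    with 0 F0 have "walk G x [v] v \<and> length [v] = F x + 1" by (auto simp: walk_def)
    then show ?case by blast
  next
    case (Suc k)
    then have "x \<noteq> v" using F0 by auto
    then obtain y where y: "y \<in> verts G" "{x, y} \<in> edges G" "F x = Suc (F y)"
      using desc Suc.prems by blast
    then obtain p where p: "walk G y p v" "length p = F y + 1" using Suc by fastforce
    then have "hd p = y" "p \<noteq> []" by (auto simp: walk_def)
    then have "walk G x (x # p) v \<and> length (x # p) = F x + 1" using p y Suc.prems by (auto simp: walk_Cons)
    then show ?case by blast
  qed
  have lower: "F x + 1 \<le> length p" if "walk G x p v" for x p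
    using that
  proof (induction p arbitrary: x)
    case Nil
    then show ?case by (simp add: walk_def)
  next
    case (Cons z p)
    show ?case
    proof (cases "p = []")
      case True
      then show ?thesis using Cons F0 by (auto simp: walk_Cons)
    next
      case False
      then have w: "z = x" "x \<in> verts G" "{x, hd p} \<in> edges G" "walk G (hd p) p v"
        using Cons.prems by (auto simp: walk_Cons)
      have "hd p \<in> verts G" using w False by (auto simp: walk_def)
      then have "F x \<le> Suc (F (hd p))" using lip w by blast
      then show ?thesis using Cons.IH[OF w(4)] by simp
    qed
  qed
  show ?thesis unfolding distance_def
    by (rule Least_equality) (use ex[OF u] lower in fastforce)+
qed

lemma isomorphic_sym:
  assumes "isomorphic G H"
  shows "isomorphic H G"
proof -
  obtain f where f: "bij_betw f (verts G) (verts H)"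
    and e: "\<forall>u\<in>verts G. \<forall>v\<in>verts G. {u, v} \<in> edges G \<longleftrightarrow> {f u, f v} \<in> edges H"
    using assms unfolding isomorphic_def by blast
  have "bij_betw (inv_into (verts G) f) (verts H) (verts G)" using f by (rule bij_betw_inv_into)
  moreover have "{u, v} \<in> edges H \<longleftrightarrow> {inv_into (verts G) f u, inv_into (verts G) f v} \<in> edges G"
    if "u \<in> verts H" "v \<in> verts H" for u v
    using e f that
    by (smt (verit) bij_betw_imp_surj_on bij_betw_inv_into_right inv_into_into)
  ultimately show ?thesis unfolding isomorphic_def by blast
qed

lemma walk_map:
  assumes f: "bij_betw f (verts G) (verts H)"
    and e: "\<forall>u\<in>verts G. \<forall>v\<in>verts G. {u, v} \<in> edges G \<longleftrightarrow> {f u, f v} \<in> edges H"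
    and "set p \<subseteq> verts G" "u \<in> verts G" "v \<in> verts G"
  shows "walk H (f u) (map f p) (f v) \<longleftrightarrow> walk G u p v"
  using assms(3-5)
proof (induction p arbitrary: u)
  case Nil
  then show ?case by (simp add: walk_def)
next
  case (Cons x p)
  have inj: "f a = f b \<longleftrightarrow> a = b" if "a \<in> verts G" "b \<in> verts G" for a b
    using f that by (auto simp: bij_betw_def inj_on_def)
  have "f a \<in> verts H" if "a \<in> verts G" for a using f that by (auto simp: bij_betw_def)
  moreover have "p \<noteq> [] \<Longrightarrow> hd p \<in> verts G" using Cons.prems by (cases p) auto
  ultimately show ?case using Cons e
    by (auto simp: walk_Cons inj hd_map)
qed

lemma isomorphic_wiener:
  assumes "isomorphic G H"
  shows "wiener G = wiener H"
proof -
  obtain f where f: "bij_betw f (verts G) (verts H)"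
    and e: "\<forall>u\<in>verts G. \<forall>v\<in>verts G. {u, v} \<in> edges G \<longleftrightarrow> {f u, f v} \<in> edges H"
    using assms unfolding isomorphic_def by blast
  have inj: "inj_on f (verts G)" and im: "f ` verts G = verts H" using f by (auto simp: bij_betw_def)
  have ex: "(\<exists>p. walk H (f u) p (f v) \<and> length p = k) \<longleftrightarrow> (\<exists>p. walk G u p v \<and> length p = k)"
    if uv: "u \<in> verts G" "v \<in> verts G" for u v k
  proof
    assume "\<exists>p. walk H (f u) p (f v) \<and> length p = k"
    then obtain p where p: "walk H (f u) p (f v)" "length p = k" by blast
    then have "set p \<subseteq> f ` verts G" by (auto simp: walk_def im)
    \<comment> \<open>Every list over the image of \<open>f\<close> is the image of a list over
      \<open>verts G\<close>, so walks can be pulled back.\<close>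
    then have "p \<in> map f ` lists (verts G)" unfolding lists_image[symmetric] by auto
    then obtain q where q: "set q \<subseteq> verts G" "p = map f q" by auto
    then show "\<exists>p. walk G u p v \<and> length p = k" using p walk_map[OF f e q(1) uv] by auto
  next
    assume "\<exists>p. walk G u p v \<and> length p = k"
    then obtain p where p: "walk G u p v" "length p = k" by blast
    then have "set p \<subseteq> verts G" by (auto simp: walk_def)
    then show "\<exists>p. walk H (f u) p (f v) \<and> length p = k"
      using p walk_map[OF f e _ uv] by (metis length_map)
  qed
  have dist: "distance H (f u) (f v) = distance G u v" if "u \<in> verts G" "v \<in> verts G" for u v
    unfolding distance_def using ex[OF that] by simp
  have bij: "bij_betw ((`) f) {S. S \<subseteq> verts G \<and> card S = 2} {S. S \<subseteq> verts H \<and> card S = 2}"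
  proof (rule bij_betwI')
    fix S T assume "S \<in> {S. S \<subseteq> verts G \<and> card S = 2}" "T \<in> {S. S \<subseteq> verts G \<and> card S = 2}"
    then show "(f ` S = f ` T) = (S = T)" using inj by (simp add: inj_on_image_eq_iff)
  next
    fix S assume "S \<in> {S. S \<subseteq> verts G \<and> card S = 2}"
    then show "f ` S \<in> {S. S \<subseteq> verts H \<and> card S = 2}"
      using inj im by (auto simp: card_image inj_on_subset)
  next
    fix T assume T: "T \<in> {S. S \<subseteq> verts H \<and> card S = 2}"
    then obtain S where "S \<subseteq> verts G" "T = f ` S" using im by (metis (mono_tags) mem_Collect_eq subset_imageE)
    then show "\<exists>S\<in>{S. S \<subseteq> verts G \<and> card S = 2}. T = f ` S"
      using T inj by (auto simp: card_image inj_on_subset)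
  qed
  have "wiener H = (\<Sum>S | S \<subseteq> verts G \<and> card S = 2.
     THE d. \<exists>u v. f ` S = {u, v} \<and> d = distance H u v)"
    unfolding wiener_def by (rule sum.reindex_bij_betw[OF bij, symmetric])
  also have "\<dots> = wiener G" unfolding wiener_def
  proof (rule sum.cong[OF refl])
    fix S assume "S \<in> {S. S \<subseteq> verts G \<and> card S = 2}"
    then obtain u v where S: "S = {u, v}" "u \<in> verts G" "v \<in> verts G" by (auto simp: card_2_iff)
    have pair: "(\<exists>a b. {x, y} = {a, b} \<and> P a b) \<longleftrightarrow> P x y \<or> P y x" for x y :: 'c and P
      by (auto simp: doubleton_eq_iff)
    \<comment> \<open>The two predicates under \<open>THE\<close> agree for every \<open>d\<close>,
      so the chosen values agree even before symmetry of the distance is known.\<close>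
    have "(\<exists>u v. f ` S = {u, v} \<and> d = distance H u v) \<longleftrightarrow> (\<exists>u v. S = {u, v} \<and> d = distance G u v)" for d
      using S dist by (auto simp: pair)
    then show "(THE d. \<exists>u v. f ` S = {u, v} \<and> d = distance H u v) = (THE d. \<exists>u v. S = {u, v} \<and> d = distance G u v)"
      by simp
  qed
  finally show ?thesis by simp
qed

text \<open>Ordered pairs form a product, so the doubled index can later be split and its sums
  interchanged.\<close>

lemma two_wiener:
  assumes fin: "finite (verts G)"
    and sym: "\<And>u v. u \<in> verts G \<Longrightarrow> v \<in> verts G \<Longrightarrow> distance G u v = distance G v u"
    and zero: "\<And>u. u \<in> verts G \<Longrightarrow> distance G u u = 0"
  shows "2 * wiener G = (\<Sum>u\<in>verts G. \<Sum>v\<in>verts G. distance G u v)"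
proof -
  let ?V = "verts G"
  let ?P = "{p \<in> ?V \<times> ?V. fst p \<noteq> snd p}"
  let ?f = "\<lambda>p. {fst p, snd p}"
  let ?d = "\<lambda>p. distance G (fst p) (snd p)"
  let ?S = "{S. S \<subseteq> ?V \<and> card S = 2}"
  have finS: "finite ?S" using fin by simp
  have "(\<Sum>u\<in>?V. \<Sum>v\<in>?V. distance G u v) = (\<Sum>p\<in>?V \<times> ?V. ?d p)"
    by (simp add: sum.cartesian_product case_prod_unfold)
  also have "\<dots> = (\<Sum>p\<in>?P. ?d p)"
    by (rule sum.mono_neutral_right) (use fin zero in auto)
  \<comment> \<open>Ordered pairs are grouped by their underlying set; each group consists of the
    two orders of one pair.\<close>
  also have "\<dots> = (\<Sum>S\<in>?S. \<Sum>p\<in>{p\<in>?P. ?f p = S}. ?d p)"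
    by (rule sum.group[symmetric]) (use fin in auto)
  also have "\<dots> = (\<Sum>S\<in>?S. 2 * (THE d. \<exists>u v. S = {u, v} \<and> d = distance G u v))"
  proof (rule sum.cong[OF refl])
    fix S assume "S \<in> ?S"
    then obtain u v where S: "S = {u, v}" "u \<in> ?V" "v \<in> ?V" "u \<noteq> v" by (auto simp: card_2_iff)
    then have "{p\<in>?P. ?f p = S} = {(u, v), (v, u)}" by (auto simp: doubleton_eq_iff)
    moreover have "(THE d. \<exists>u v. S = {u, v} \<and> d = distance G u v) = distance G u v"
      using S sym by (intro the_equality) (auto simp: doubleton_eq_iff)
    ultimately show "(\<Sum>p\<in>{p\<in>?P. ?f p = S}. ?d p) = 2 * (THE d. \<exists>u v. S = {u, v} \<and> d = distance G u v)"
      using S sym by simp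
  qed
  finally show ?thesis by (simp add: wiener_def sum_distrib_left)
qed

section \<open>Distances on a cycle\<close>

text \<open>The shorter of the two arcs between the positions \<open>i\<close> and \<open>j\<close>.
  The case split keeps the subtraction of natural numbers from truncating.\<close>

definition cdist :: "nat \<Rightarrow> nat \<Rightarrow> nat \<Rightarrow> nat" where
  "cdist g i j = (if i \<le> j then min (j - i) (g - (j - i)) else min (i - j) (g - (i - j)))"

lemma Suc_mod_eq: "i < g \<Longrightarrow> Suc i mod g = (if Suc i = g then 0 else Suc i)"
  by (simp add: mod_Suc)

lemma cdist_sym: "cdist g i j = cdist g j i"
  by (auto simp: cdist_def)

lemma cdist_self [simp]: "cdist g i i = 0"
  by (simp add: cdist_def)

lemma cdist_pos: "i < g \<Longrightarrow> j < g \<Longrightarrow> i \<noteq> j \<Longrightarrow> 0 < cdist g i j"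
  by (auto simp: cdist_def)

lemma cdist_Suc:
  assumes "i < g" "j < g"
  shows "cdist g (Suc i mod g) j \<le> Suc (cdist g i j)"
    and "cdist g i j \<le> Suc (cdist g (Suc i mod g) j)"
  using assms by (auto simp: cdist_def Suc_mod_eq)

lemma cdist_rotate:
  assumes "i < g" "j < g"
  shows "cdist g (Suc i mod g) (Suc j mod g) = cdist g i j"
  using assms by (auto simp: cdist_def Suc_mod_eq min_def)

text \<open>A step along the shorter arc; this is the descent that \<open>distance_eqI\<close> asks
  for on the cycle.\<close>

lemma cdist_descent:
  assumes "i < g" "j < g" "i \<noteq> j"
  shows "\<exists>k<g. (k = Suc i mod g \<or> i = Suc k mod g) \<and> cdist g i j = Suc (cdist g k j)"
proof -
  \<comment> \<open>\<open>p\<close> is the cyclic predecessor of \<open>i\<close>.\<close>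
  define p where "p = (if i = 0 then g - 1 else i - 1)"
  have p: "p < g" "i = Suc p mod g" using assms by (auto simp: p_def)
  consider "i < j" "j - i \<le> g - (j - i)" | "i < j" "j - i > g - (j - i)"
    | "j < i" "i - j \<le> g - (i - j)" | "j < i" "i - j > g - (i - j)" using assms(3) by linarith
  then have "cdist g i j = Suc (cdist g (Suc i mod g) j) \<or> cdist g i j = Suc (cdist g p j)"
  proof cases
    case 1
    then have "cdist g i j = Suc (cdist g (Suc i mod g) j)"
      using assms by (simp add: cdist_def Suc_mod_eq)
    then show ?thesis ..
  next
    case 2
    then have "cdist g i j = Suc (cdist g p j)"
      using assms by (cases "i = 0") (auto simp: p_def cdist_def)
    then show ?thesis ..
  next
    case 3
    then have "cdist g i j = Suc (cdist g p j)" using assms by (auto simp: p_def cdist_def)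
    then show ?thesis ..
  next
    case 4
    then have "cdist g i j = Suc (cdist g (Suc i mod g) j)"
      using assms by (cases "Suc i = g") (auto simp: cdist_def Suc_mod_eq)
    then show ?thesis ..
  qed
  then show ?thesis
  proof
    assume "cdist g i j = Suc (cdist g (Suc i mod g) j)"
    moreover have "Suc i mod g < g" using assms by simp
    ultimately show ?thesis by blast
  next
    assume "cdist g i j = Suc (cdist g p j)"
    then show ?thesis using p by blast
  qed
qed

lemma cdist_1:
  assumes "i < g" "j < g" "cdist g i j = 1"
  shows "j = Suc i mod g \<or> i = Suc j mod g"
  using assms by (auto simp: cdist_def Suc_mod_eq min_def split: if_splits)

lemma bij_betw_rotate:
  fixes g :: nat
  assumes g: "0 < g"
  shows "bij_betw (\<lambda>i. (i + k) mod g) {..<g} {..<g}"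
proof -
  have *: "i = j" if "i < g" "j < g" "(i + k) mod g = (j + k) mod g" "i \<le> j" for i j
  proof -
    have "g dvd j - i"
      using mod_eq_dvd_iff_nat[of "i + k" "j + k" g] that(3)[symmetric] that(4) by simp
    moreover have "j - i < g" using that by simp
    ultimately show "i = j" using that(4) nat_dvd_not_less by fastforce
  qed
  have "inj_on (\<lambda>i. (i + k) mod g) {..<g}"
  proof (rule inj_onI)
    fix i j assume "i \<in> {..<g}" "j \<in> {..<g}" "(i + k) mod g = (j + k) mod g"
    then show "i = j" using *[of i j] *[of j i] by (cases "i \<le> j") auto
  qed
  moreover have "(\<lambda>i. (i + k) mod g) ` {..<g} = {..<g}"
    by (rule endo_inj_surj[OF _ _ calculation]) (use g in \<open>simp_all add: image_subset_iff\<close>)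
  ultimately show ?thesis unfolding bij_betw_def by blast
qed

text \<open>The cycle looks the same from each of its vertices: rotating both arguments by one
  carries a row of distances to the next.\<close>

lemma sum_cdist: "i < g \<Longrightarrow> (\<Sum>j<g. cdist g i j) = (\<Sum>j<g. cdist g 0 j)"
proof (induction i)
  case (Suc i)
  then have "(\<Sum>j<g. cdist g (Suc i) j) = (\<Sum>j<g. cdist g (Suc i) ((j + 1) mod g))"
    by (intro sum.reindex_bij_betw[symmetric] bij_betw_rotate) simp
  also have "\<dots> = (\<Sum>j<g. cdist g i j)"
  proof (rule sum.cong[OF refl])
    fix j assume "j \<in> {..<g}"
    then show "cdist g (Suc i) ((j + 1) mod g) = cdist g i j"
      using cdist_rotate[of i g j] Suc.prems by (simp add: Suc_mod_eq[of i])
  qed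
  finally show ?case using Suc by simp
qed simp

section \<open>Cycles with attached trees\<close>

text \<open>The numbering \<open>c\<close> of the cycle is kept apart from the parent map, so that
  rotating or reflecting it leaves the tree data unchanged. The decreasing height \<open>h\<close>
  makes every chain of parents end on the cycle; it need not be the distance to it.\<close>

locale rooted_unicycle =
  fixes G :: "'a ugraph" and g :: nat and c :: "nat \<Rightarrow> 'a"
    and par :: "'a \<Rightarrow> 'a" and h :: "'a \<Rightarrow> nat"
  assumes finite_verts: "finite (verts G)"
    and g_ge_3: "3 \<le> g"
    and inj_c: "inj_on c {..<g}"
    and c_verts: "c ` {..<g} \<subseteq> verts G"
    and par_verts: "v \<in> verts G - c ` {..<g} \<Longrightarrow> par v \<in> verts G"
    and h_par: "v \<in> verts G - c ` {..<g} \<Longrightarrow> h (par v) < h v"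
    and edges_eq: "edges G = (\<lambda>i. {c i, c (Suc i mod g)}) ` {..<g}
      \<union> (\<lambda>v. {v, par v}) ` (verts G - c ` {..<g})"
begin

definition T :: "'a set" where
  "T = verts G - c ` {..<g}"

text \<open>The pairs start only at vertices of \<open>T\<close>, so a chain of parents stops as
  soon as it meets the cycle.\<close>

definition anc :: "'a \<Rightarrow> 'a \<Rightarrow> bool" where
  "anc z v \<longleftrightarrow> (v, z) \<in> {(v, par v) | v. v \<in> T}\<^sup>*"

definition root :: "'a \<Rightarrow> nat" where
  "root v = (THE i. i < g \<and> anc (c i) v)"

text \<open>The bridge from \<open>z\<close> to its parent separates \<open>u\<close> from
  \<open>v\<close> exactly when \<open>z\<close> is an ancestor of just one of them.\<close>

definition tree_dist :: "'a \<Rightarrow> 'a \<Rightarrow> nat" where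
  "tree_dist u v = (\<Sum>z\<in>T. of_bool (anc z u \<noteq> anc z v)) + cdist g (root u) (root v)"

definition sub :: "'a \<Rightarrow> nat" where
  "sub z = card {v \<in> verts G. anc z v}"

lemma finite_T [simp]: "finite T"
  using finite_verts by (simp add: T_def)

lemma T_verts: "v \<in> T \<Longrightarrow> v \<in> verts G"
  by (simp add: T_def)

lemma c_in_verts [simp]: "i < g \<Longrightarrow> c i \<in> verts G"
  using c_verts by auto

lemma c_notin_T [simp]: "i < g \<Longrightarrow> c i \<notin> T"
  by (simp add: T_def)

lemma c_eq_iff [simp]: "i < g \<Longrightarrow> j < g \<Longrightarrow> c i = c j \<longleftrightarrow> i = j"
  using inj_c by (auto simp: inj_on_def)

lemma verts_cases:
  assumes "v \<in> verts G"
  obtains "v \<in> T" | i where "i < g" "v = c i"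
  using assms unfolding T_def by blast

lemma par_in_verts [simp]: "v \<in> T \<Longrightarrow> par v \<in> verts G"
  using par_verts by (simp add: T_def)

lemma h_par': "v \<in> T \<Longrightarrow> h (par v) < h v"
  using h_par by (simp add: T_def)

lemma par_neq: "v \<in> T \<Longrightarrow> par v \<noteq> v"
  using h_par' by fastforce

lemma edges_cases:
  assumes "{x, y} \<in> edges G"
  obtains "x \<in> T" "y = par x" | "y \<in> T" "x = par y"
    | i where "i < g" "x = c i" "y = c (Suc i mod g)" | i where "i < g" "y = c i" "x = c (Suc i mod g)"
  using assms unfolding edges_eq T_def[symmetric] by (auto simp: doubleton_eq_iff)

lemma par_edge: "v \<in> T \<Longrightarrow> {v, par v} \<in> edges G"
  unfolding edges_eq T_def[symmetric] by blast

lemma c_edge: "i < g \<Longrightarrow> {c i, c (Suc i mod g)} \<in> edges G"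
  unfolding edges_eq by blast

lemma anc_refl [simp]: "anc v v"
  by (simp add: anc_def)

lemma anc_c [simp]: "i < g \<Longrightarrow> anc z (c i) \<longleftrightarrow> z = c i"
  unfolding anc_def by (auto elim: converse_rtranclE)

lemma anc_T: "v \<in> T \<Longrightarrow> anc z v \<longleftrightarrow> z = v \<or> anc z (par v)"
  unfolding anc_def by (auto elim: converse_rtranclE intro: converse_rtrancl_into_rtrancl)

lemma anc_trans: "anc x y \<Longrightarrow> anc y z \<Longrightarrow> anc x z"
  unfolding anc_def by auto

lemma anc_verts: "anc z v \<Longrightarrow> v \<in> verts G \<Longrightarrow> z \<in> verts G"
  unfolding anc_def by (induction rule: rtrancl_induct) auto

lemma anc_h: "anc z v \<Longrightarrow> z = v \<or> h z < h v"
  unfolding anc_def by (induction rule: rtrancl_induct) (auto dest: h_par')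

lemma anc_child:
  assumes "anc x v" "x \<noteq> v"
  obtains y where "y \<in> T" "par y = x" "anc y v"
  using assms unfolding anc_def by (auto elim: rtranclE)

lemma not_anc_par: "v \<in> T \<Longrightarrow> \<not> anc v (par v)"
  using anc_h h_par' par_neq by (metis less_asym)

text \<open>Induction on the height: a tree vertex has the same cycle ancestors as its parent, and a
  cycle vertex has no ancestor but itself.\<close>

lemma ex1_root:
  assumes "v \<in> verts G"
  shows "\<exists>!i. i < g \<and> anc (c i) v"
  using assms
proof (induction "h v" arbitrary: v rule: less_induct)
  case less
  from less.prems show ?case
  proof (cases rule: verts_cases)
    case 1
    then have "\<exists>!i. i < g \<and> anc (c i) (par v)" using less h_par' by simp
    then show ?thesis using 1 by (metis anc_T c_notin_T)
  qed auto
qed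

lemma root_lt [simp]: "v \<in> verts G \<Longrightarrow> root v < g"
  and anc_root: "v \<in> verts G \<Longrightarrow> anc (c (root v)) v"
  using theI'[OF ex1_root] unfolding root_def by blast+

lemma root_c [simp]: "i < g \<Longrightarrow> root (c i) = i"
  unfolding root_def by (rule the_equality) auto

lemma root_par: "v \<in> T \<Longrightarrow> root (par v) = root v"
  unfolding root_def by (rule arg_cong[of _ _ The]) (use anc_T in fastforce)

lemma root_eqI: "v \<in> verts G \<Longrightarrow> i < g \<Longrightarrow> anc (c i) v \<Longrightarrow> root v = i"
  using ex1_root[of v] anc_root[of v] root_lt[of v] by blast

lemma tree_dist_sym: "tree_dist u v = tree_dist v u"
  unfolding tree_dist_def by (simp add: cdist_sym eq_commute)

lemma tree_dist_self [simp]: "tree_dist u u = 0"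
  unfolding tree_dist_def by simp

text \<open>Only the bridge above \<open>x\<close> distinguishes \<open>x\<close> from its parent,
  so the value changes by exactly one; the direction depends on whether \<open>v\<close> lies below
  \<open>x\<close>.\<close>

lemma tree_dist_par:
  assumes "x \<in> T"
  shows "tree_dist x v + of_bool (anc x v) = tree_dist (par x) v + of_bool (\<not> anc x v)"
proof -
  have *: "(\<Sum>z\<in>T. of_bool (anc z u \<noteq> anc z v)) =
      of_bool (anc x u \<noteq> anc x v) + (\<Sum>z\<in>T - {x}. of_bool (anc z u \<noteq> anc z v))" for u
    using assms by (simp add: sum.remove)
  have "(\<Sum>z\<in>T - {x}. of_bool (anc z x \<noteq> anc z v)) = (\<Sum>z\<in>T - {x}. of_bool (anc z (par x) \<noteq> anc z v))"
    using assms by (intro sum.cong) (auto simp: anc_T)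
  then show ?thesis
    using assms unfolding tree_dist_def *[of x] *[of "par x"] by (simp add: not_anc_par root_par del: sum_of_bool_eq)
qed

text \<open>No vertex of \<open>T\<close> is an ancestor of a cycle vertex, so the bridge term is
  the same for all of them.\<close>

lemma tree_dist_c:
  assumes "i < g" "j < g"
  shows "tree_dist (c i) v + cdist g j (root v) = tree_dist (c j) v + cdist g i (root v)"
proof -
  have "(\<Sum>z\<in>T. of_bool (anc z (c i) \<noteq> anc z v)) = (\<Sum>z\<in>T. of_bool (anc z (c j) \<noteq> anc z v))"
    using assms by (intro sum.cong) auto
  then show ?thesis using assms unfolding tree_dist_def by (simp del: sum_of_bool_eq)
qed

lemma distance_eq:
  assumes u: "u \<in> verts G" and v: "v \<in> verts G"
  shows "distance G u v = tree_dist u v"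
proof (rule distance_eqI[OF u v tree_dist_self])
  fix x y assume e: "{x, y} \<in> edges G"
  have mod: "Suc i mod g < g" for i using g_ge_3 by simp
  from e show "tree_dist x v \<le> Suc (tree_dist y v)"
  proof (cases rule: edges_cases)
    case 1
    then show ?thesis using tree_dist_par[of x v] by (auto simp: of_bool_def split: if_splits)
  next
    case 2
    then show ?thesis using tree_dist_par[of y v] by (auto simp: of_bool_def split: if_splits)
  next
    case (3 i)
    then show ?thesis
      using tree_dist_c[of i "Suc i mod g" v] cdist_Suc[of i g "root v"] v mod by simp
  next
    case (4 i)
    then show ?thesis
      using tree_dist_c[of i "Suc i mod g" v] cdist_Suc[of i g "root v"] v mod by simp
  qed
next
  fix x assume x: "x \<in> verts G" "x \<noteq> v"
  show "\<exists>y\<in>verts G. {x, y} \<in> edges G \<and> tree_dist x v = Suc (tree_dist y v)"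
  \<comment> \<open>Above \<open>v\<close> the next vertex is the child on the way to
    \<open>v\<close>; elsewhere it is the parent or, on the cycle, a neighbour nearer to the root of
    \<open>v\<close>.\<close>
  proof (cases "anc x v")
    case True
    then obtain y where y: "y \<in> T" "par y = x" "anc y v" using x anc_child by metis
    then show ?thesis
      using tree_dist_par[of y v] par_edge[of y] T_verts[of y] by (intro bexI[of _ y]) (auto simp: insert_commute)
  next
    case nanc: False
    from x(1) show ?thesis
    proof (cases rule: verts_cases)
      case 1
      then show ?thesis using tree_dist_par[of x v] nanc par_edge[of x] by (intro bexI[of _ "par x"]) auto
    next
      case (2 i)
      then have "i \<noteq> root v" using nanc anc_root v by blast
      then obtain k where k: "k < g" "k = Suc i mod g \<or> i = Suc k mod g"
        "cdist g i (root v) = Suc (cdist g k (root v))"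
        using cdist_descent[of i g "root v"] 2 v by auto
      then have "{c i, c k} \<in> edges G" using c_edge[of i] c_edge[of k] 2 by (auto simp: insert_commute)
      then show ?thesis using tree_dist_c[of i k v] k 2 by (intro bexI[of _ "c k"]) auto
    qed
  qed
qed

end

section \<open>Estimates for the bridge sum and the root sum\<close>

lemma sum_of_bool_neq:
  assumes "finite V"
  shows "(\<Sum>u\<in>V. \<Sum>v\<in>V. of_bool (P u \<noteq> P v)) = 2 * (card {v \<in> V. P v} * (card V - card {v \<in> V. P v}))"
proof -
  have neg: "card {v \<in> V. \<not> P v} = card V - card {v \<in> V. P v}"
    using assms by (subst card_Diff_subset[symmetric]) (auto intro: arg_cong[where f = card])
  have "(\<Sum>v\<in>V. of_bool (P u \<noteq> P v) :: nat) = (if P u then card {v \<in> V. \<not> P v} else card {v \<in> V. P v})" for u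
    using assms by (auto simp: Collect_conj_eq[symmetric] Int_def)
  then have "(\<Sum>u\<in>V. \<Sum>v\<in>V. of_bool (P u \<noteq> P v)) =
      (\<Sum>u\<in>V. if P u then card {v \<in> V. \<not> P v} else card {v \<in> V. P v})" by simp
  also have "\<dots> = card {v \<in> V. P v} * card {v \<in> V. \<not> P v} + card {v \<in> V. \<not> P v} * card {v \<in> V. P v}"
    using assms by (simp add: sum.If_cases Int_def)
  finally show ?thesis by (simp add: neg)
qed

lemma sum_square_le_square_sum:
  fixes y :: "'b \<Rightarrow> nat"
  assumes "finite R"
  shows "(\<Sum>i\<in>R. y i * y i) \<le> (\<Sum>i\<in>R. y i) * (\<Sum>i\<in>R. y i)"
proof -
  have "(\<Sum>i\<in>R. y i * y i) \<le> (\<Sum>i\<in>R. y i * (\<Sum>i\<in>R. y i))"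
    using assms by (intro sum_mono mult_left_mono member_le_sum) auto
  then show ?thesis by (simp add: sum_distrib_right)
qed

text \<open>For s = 1 the bonus n - 3 fills the gap between n - 1 and 2 (n - 2) exactly. For larger
  s the product s (n - s) is concave with the value 2 (n - 2) at s = 2 and s = n - 2, and the latter
  is excluded by s + 3 <= n.\<close>

lemma mult_diff_ge:
  fixes n s :: nat
  assumes "1 \<le> s" "s + 3 \<le> n"
  shows "2 * (n - 2) \<le> s * (n - s) + of_bool (s = 1) * (n - 3)"
    and "s * (n - s) + of_bool (s = 1) * (n - 3) = 2 * (n - 2) \<longleftrightarrow> s \<le> 2"
proof -
  obtain k where k: "n = s + 3 + k" using assms(2) le_Suc_ex by blast
  have "s = 1 \<or> (\<exists>t. s = t + 2)" using assms(1) by presburger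
  then consider "s = 1" | t where "s = t + 2" by blast
  then have "2 * (n - 2) \<le> s * (n - s) + of_bool (s = 1) * (n - 3) \<and>
    (s * (n - s) + of_bool (s = 1) * (n - 3) = 2 * (n - 2) \<longleftrightarrow> s \<le> 2)"
    by cases (auto simp: k algebra_simps)
  then show "2 * (n - 2) \<le> s * (n - s) + of_bool (s = 1) * (n - 3)"
    and "s * (n - s) + of_bool (s = 1) * (n - 3) = 2 * (n - 2) \<longleftrightarrow> s \<le> 2" by blast+
qed

context rooted_unicycle
begin

lemma verts_eq: "verts G = c ` {..<g} \<union> T"
  using c_verts by (auto simp: T_def)

lemma sum_verts: "(\<Sum>v\<in>verts G. f v) = (\<Sum>i<g. f (c i)) + (\<Sum>v\<in>T. f v)"
  for f :: "'a \<Rightarrow> nat"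
proof -
  have "(\<Sum>v\<in>verts G. f v) = (\<Sum>v\<in>c ` {..<g}. f v) + (\<Sum>v\<in>T. f v)"
    unfolding verts_eq by (rule sum.union_disjoint) auto
  then show ?thesis using inj_c by (simp add: sum.reindex)
qed

lemma card_verts: "card (verts G) = g + card T"
  using sum_verts[of "\<lambda>_. 1"] by simp

definition bridge_sum :: nat where
  "bridge_sum = (\<Sum>z\<in>T. sub z * (card (verts G) - sub z))"

definition root_sum :: nat where
  "root_sum = (\<Sum>u\<in>T. \<Sum>v\<in>T. cdist g (root u) (root v))"

definition leaves :: "'a set" where
  "leaves = {z \<in> T. sub z = 1}"

lemma two_wiener_eq:
  "2 * wiener G = 2 * bridge_sum + (\<Sum>i<g. \<Sum>j<g. cdist g i j)
    + 2 * card T * (\<Sum>j<g. cdist g 0 j) + root_sum"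
proof -
  let ?V = "verts G"
  have "2 * wiener G = (\<Sum>u\<in>?V. \<Sum>v\<in>?V. distance G u v)"
    using finite_verts by (rule two_wiener) (simp_all add: distance_eq tree_dist_sym)
  also have "\<dots> = (\<Sum>u\<in>?V. \<Sum>v\<in>?V. \<Sum>z\<in>T. of_bool (anc z u \<noteq> anc z v))
      + (\<Sum>u\<in>?V. \<Sum>v\<in>?V. cdist g (root u) (root v))"
    by (simp add: distance_eq tree_dist_def sum.distrib)
  also have "(\<Sum>u\<in>?V. \<Sum>v\<in>?V. \<Sum>z\<in>T. of_bool (anc z u \<noteq> anc z v)) =
      (\<Sum>z\<in>T. \<Sum>u\<in>?V. \<Sum>v\<in>?V. of_bool (anc z u \<noteq> anc z v))"
    by (simp only: sum.swap[of _ T ?V])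
  \<comment> \<open>The inner double sum counts the ordered pairs cut by the bridge above
    \<open>z\<close>.\<close>
  also have "\<dots> = 2 * bridge_sum"
    using finite_verts by (simp only: sum_of_bool_neq) (simp add: bridge_sum_def sub_def sum_distrib_left)
  \<comment> \<open>Splitting both indices into cycle and \<open>T\<close> gives four blocks. The
    mixed ones depend only on \<open>card T\<close>, because all rows of \<open>cdist\<close> have
    the same sum.\<close>
  also have "(\<Sum>u\<in>?V. \<Sum>v\<in>?V. cdist g (root u) (root v)) =
      (\<Sum>i<g. \<Sum>j<g. cdist g i j) + (\<Sum>i<g. \<Sum>v\<in>T. cdist g i (root v))
      + (\<Sum>u\<in>T. \<Sum>j<g. cdist g (root u) j) + root_sum"
    by (simp add: sum_verts sum.distrib root_sum_def)
  also have "(\<Sum>i<g. \<Sum>v\<in>T. cdist g i (root v)) = (\<Sum>u\<in>T. \<Sum>j<g. cdist g (root u) j)"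
    by (simp add: sum.swap[of _ "{..<g}"] cdist_sym)
  also have "(\<Sum>u\<in>T. \<Sum>j<g. cdist g (root u) j) = card T * (\<Sum>j<g. cdist g 0 j)"
    by (simp add: sum_cdist T_verts)
  finally show ?thesis by simp
qed

text \<open>The descendants of \<open>z\<close> stay in \<open>T\<close>, so at least the three or
  more cycle vertices are left over.\<close>

lemma sub_bounds:
  assumes "z \<in> T"
  shows "1 \<le> sub z" "sub z + 3 \<le> card (verts G)"
proof -
  have "z \<in> {v \<in> verts G. anc z v}" using assms T_verts by simp
  then show "1 \<le> sub z" unfolding sub_def using finite_verts card_0_eq by (fastforce simp: Suc_le_eq card_gt_0_iff)
  have "{v \<in> verts G. anc z v} \<subseteq> T" using assms by (auto elim: verts_cases)
  then have "sub z \<le> card T" unfolding sub_def by (simp add: card_mono)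
  then show "sub z + 3 \<le> card (verts G)" using card_verts g_ge_3 by simp
qed

lemma bridge_sum_ge:
  "2 * (card (verts G) - 2) * card T \<le> bridge_sum + card leaves * (card (verts G) - 3)" (is "?a \<le> ?b")
  and bridge_sum_eq_iff: "bridge_sum + card leaves * (card (verts G) - 3)
    = 2 * (card (verts G) - 2) * card T \<longleftrightarrow> (\<forall>z\<in>T. sub z \<le> 2)"
proof -
  let ?n = "card (verts G)"
  let ?f = "\<lambda>z. sub z * (?n - sub z) + of_bool (sub z = 1) * (?n - 3)"
  have eq: "?b = (\<Sum>z\<in>T. ?f z)"
    unfolding bridge_sum_def sum.distrib leaves_def
    by (simp add: sum_distrib_right[symmetric] Int_def del: sum_of_bool_mult_eq)
  have eq': "?a = (\<Sum>z\<in>T. 2 * (?n - 2))" by simp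
  have le: "2 * (?n - 2) \<le> ?f z" if "z \<in> T" for z
    using mult_diff_ge(1)[OF sub_bounds[OF that]] .
  show "?a \<le> ?b" unfolding eq eq' by (intro sum_mono le)
  have "(\<Sum>z\<in>T. 2 * (?n - 2)) = (\<Sum>z\<in>T. ?f z) \<longleftrightarrow> (\<forall>z\<in>T. 2 * (?n - 2) = ?f z)"
  proof
    assume "(\<Sum>z\<in>T. 2 * (?n - 2)) = (\<Sum>z\<in>T. ?f z)"
    note eq_sum = this
    show "\<forall>z\<in>T. 2 * (?n - 2) = ?f z"
    proof
      fix z assume "z \<in> T"
      show "2 * (?n - 2) = ?f z" by (rule sum_mono_inv[OF eq_sum le \<open>z \<in> T\<close> finite_T])
    qed
  next
    assume all: "\<forall>z\<in>T. 2 * (?n - 2) = ?f z"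
    show "(\<Sum>z\<in>T. 2 * (?n - 2)) = (\<Sum>z\<in>T. ?f z)" by (rule sum.cong[OF refl]) (rule bspec[OF all])
  qed
  also have "\<dots> \<longleftrightarrow> (\<forall>z\<in>T. sub z \<le> 2)"
  proof (rule ball_cong[OF refl])
    fix z assume "z \<in> T"
    show "2 * (?n - 2) = ?f z \<longleftrightarrow> sub z \<le> 2"
      by (subst eq_commute) (rule mult_diff_ge(2)[OF sub_bounds[OF \<open>z \<in> T\<close>]])
  qed
  finally show "?b = ?a \<longleftrightarrow> (\<forall>z\<in>T. sub z \<le> 2)"
    unfolding eq eq' by (subst eq_commute)
qed

text \<open>This is Q >= (m - 1) (2 N - m) without subtracted terms. Different roots are at distance
  at least 1, so Q is at least N^2 minus the sum of the squared class sizes. Writing each size as 1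
  + y, the y sum to N - m, and their squares to at most (N - m)^2.\<close>

lemma root_sum_ge:
  fixes m :: nat
  defines "m \<equiv> card (root ` T)"
  shows "m \<le> card T"
    and "card T * card T \<le> root_sum + m + 2 * (card T - m) + (card T - m) * (card T - m)"
proof -
  let ?R = "root ` T" and ?N = "card T"
  define x where "x i = card {v \<in> T. root v = i}" for i
  define y where "y i = x i - 1" for i
  have x: "x i = Suc (y i)" if "i \<in> ?R" for i
  proof -
    have "{v \<in> T. root v = i} \<noteq> {}" using that by auto
    then have "x i \<noteq> 0" by (simp add: x_def)
    then show ?thesis by (simp add: y_def)
  qed
  have "?N = (\<Sum>v\<in>T. 1)" by simp
  also have "\<dots> = (\<Sum>i\<in>?R. \<Sum>v\<in>{v \<in> T. root v = i}. 1)" by (rule sum.image_gen) simp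
  also have "\<dots> = (\<Sum>i\<in>?R. Suc (y i))" using x by (simp add: x_def)
  finally have N: "?N = m + (\<Sum>i\<in>?R. y i)" by (simp add: m_def sum_Suc)
  then show "m \<le> ?N" by simp
  have "(\<Sum>u\<in>T. x (root u)) = (\<Sum>i\<in>?R. \<Sum>v\<in>{v \<in> T. root v = i}. x (root v))" by (rule sum.image_gen) simp
  also have "\<dots> = (\<Sum>i\<in>?R. x i * x i)" by (simp add: x_def)
  also have "\<dots> = (\<Sum>i\<in>?R. 1 + 2 * y i + y i * y i)" using x by (intro sum.cong) (simp_all add: algebra_simps)
  also have "\<dots> = m + 2 * (\<Sum>i\<in>?R. y i) + (\<Sum>i\<in>?R. y i * y i)"
    unfolding sum.distrib by (simp add: m_def sum_distrib_left)
  also have "\<dots> \<le> m + 2 * (?N - m) + (?N - m) * (?N - m)"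
    using sum_square_le_square_sum[of ?R y] N by simp
  finally have sq: "(\<Sum>u\<in>T. x (root u)) \<le> m + 2 * (?N - m) + (?N - m) * (?N - m)" .
  have row: "?N \<le> (\<Sum>v\<in>T. cdist g (root u) (root v)) + x (root u)" if "u \<in> T" for u
  proof -
    have "?N = (\<Sum>v\<in>T. 1)" by simp
    also have "\<dots> \<le> (\<Sum>v\<in>T. cdist g (root u) (root v) + of_bool (root v = root u))"
      using cdist_pos that T_verts by (intro sum_mono) (fastforce simp: Suc_le_eq)
    also have "\<dots> = (\<Sum>v\<in>T. cdist g (root u) (root v)) + x (root u)"
      by (simp add: sum.distrib x_def Int_def)
    finally show ?thesis .
  qed
  have "?N * ?N = (\<Sum>u\<in>T. ?N)" by simp
  also have "\<dots> \<le> (\<Sum>u\<in>T. (\<Sum>v\<in>T. cdist g (root u) (root v)) + x (root u))"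
    by (intro sum_mono row)
  also have "\<dots> = root_sum + (\<Sum>u\<in>T. x (root u))" by (simp add: root_sum_def sum.distrib)
  finally show "?N * ?N \<le> root_sum + m + 2 * (?N - m) + (?N - m) * (?N - m)" using sq by simp
qed

section \<open>Leaves and matchings\<close>

lemma sub_less_sub_par: "z \<in> T \<Longrightarrow> sub z < sub (par z)"
proof -
  assume z: "z \<in> T"
  have "{v \<in> verts G. anc z v} \<subset> {v \<in> verts G. anc (par z) v}"
    using z not_anc_par[OF z] anc_trans[of "par z" z] anc_T[OF z] by auto
  then show ?thesis unfolding sub_def using finite_verts by (simp add: psubset_card_mono)
qed

lemma card_leaves_le:
  assumes "matching G M"
  shows "2 * card M \<le> card (verts G)"
    and "2 * card leaves + g + 2 * card M \<le> 2 * card (verts G) + card (root ` T)"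
proof -
  \<comment> \<open>\<open>U\<close> consists of the cycle vertices without a tree.\<close>
  define U where "U = c ` ({..<g} - root ` T)"
  define \<phi> :: "'a \<Rightarrow> nat" where "\<phi> v = (if v \<in> leaves then 2 else if v \<in> U then 1 else 0)" for v
  have M: "M \<subseteq> edges G" "pairwise disjnt M" using assms by (auto simp: matching_def)
  have mod: "Suc i mod g < g" for i using g_ge_3 by simp
  \<comment> \<open>The parent of a tree vertex has weight 0: it has a further descendant, so it is
    no leaf, and if it lies on the cycle it carries a tree. A cycle edge has weight at most 1 +
    1.\<close>
  have edge: "e \<subseteq> verts G \<and> card e = 2 \<and> sum \<phi> e \<le> 2" if "e \<in> edges G" for e
  proof -
    from that consider v where "v \<in> T" "e = {v, par v}" | i where "i < g" "e = {c i, c (Suc i mod g)}"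
      unfolding edges_eq T_def[symmetric] by blast
    then show ?thesis
    proof cases
      case 1
      have "par v \<notin> U" using 1(1) root_par[OF 1(1)] by (force simp: U_def)
      moreover have "par v \<notin> leaves"
        using sub_less_sub_par[OF 1(1)] sub_bounds(1)[OF 1(1)] by (auto simp: leaves_def)
      ultimately have "\<phi> (par v) = 0" by (simp add: \<phi>_def)
      moreover have "\<phi> v \<le> 2" by (simp add: \<phi>_def)
      ultimately show ?thesis using 1 par_neq[OF 1(1)] T_verts by auto
    next
      case 2
      have "\<phi> (c i) \<le> 1" "\<phi> (c (Suc i mod g)) \<le> 1" using 2 mod by (auto simp: \<phi>_def leaves_def)
      moreover have "Suc i mod g \<noteq> i" using 2 g_ge_3 by (auto simp: Suc_mod_eq)
      ultimately show ?thesis using 2 mod by auto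
    qed
  qed
  have finM: "finite M"
  proof (rule finite_subset)
    show "M \<subseteq> Pow (verts G)" using M edge by blast
  qed (use finite_verts in simp)
  have fine: "finite e" if "e \<in> M" for e using edge M that by (metis card.infinite subsetD zero_neq_numeral)
  have A: "\<Union>M \<subseteq> verts G" using M edge by blast
  have "card (\<Union>M) = sum card M" using M fine by (intro card_Union_disjoint)
  also have "\<dots> = (\<Sum>e\<in>M. 2)" by (rule sum.cong) (use M edge in auto)
  finally have cA: "card (\<Union>M) = 2 * card M" by simp
  then show nM: "2 * card M \<le> card (verts G)" using card_mono[OF finite_verts A] by simp
  have "sum \<phi> (\<Union>M) = (\<Sum>e\<in>M. sum \<phi> e)"
    using M fine by (subst sum.Union_disjoint) (auto simp: pairwise_def disjnt_def)
  also have "\<dots> \<le> (\<Sum>e\<in>M. 2)" by (intro sum_mono) (use M edge in blast)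
  finally have 1: "sum \<phi> (\<Union>M) \<le> 2 * card M" by simp
  have "sum \<phi> (verts G - \<Union>M) \<le> (\<Sum>v\<in>verts G - \<Union>M. 2)" by (intro sum_mono) (simp add: \<phi>_def)
  also have "\<dots> = 2 * (card (verts G) - 2 * card M)"
    using A cA finite_verts by (simp add: card_Diff_subset finite_subset)
  finally have 2: "sum \<phi> (verts G - \<Union>M) \<le> 2 * (card (verts G) - 2 * card M)" .
  have "sum \<phi> (verts G) = sum \<phi> (verts G - \<Union>M) + sum \<phi> (\<Union>M)"
    by (rule sum.subset_diff[OF A finite_verts])
  \<comment> \<open>Each matching edge carries weight at most 2, and so does each of the n - 2 |M|
    uncovered vertices; together this is at most 2 n - 2 |M|.\<close>
  with 1 2 nM have upper: "sum \<phi> (verts G) + 2 * card M \<le> 2 * card (verts G)" by linarith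
  have R: "root ` T \<subseteq> {..<g}" using T_verts by auto
  have "sum \<phi> (verts G) = (\<Sum>i<g. of_bool (i \<notin> root ` T)) + (\<Sum>v\<in>T. 2 * of_bool (sub v = 1))"
    unfolding sum_verts by (intro arg_cong2[of _ _ _ _ "(+)"] sum.cong)
      (auto simp: \<phi>_def leaves_def U_def)
  also have "(\<Sum>v\<in>T. 2 * of_bool (sub v = 1)) = 2 * card leaves"
    unfolding sum_distrib_left[symmetric] leaves_def by (simp add: Int_def)
  also have "(\<Sum>i<g. of_bool (i \<notin> root ` T)) = card ({..<g} - root ` T)"
    by (simp add: set_diff_eq Int_def)
  also have "\<dots> = g - card (root ` T)" using R by (simp add: card_Diff_subset)
  finally show "2 * card leaves + g + 2 * card M \<le> 2 * card (verts G) + card (root ` T)"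
    using upper card_mono[OF _ R] by simp
qed

lemma finite_edges: "finite (edges G)"
  unfolding edges_eq using finite_verts by simp

lemma ex_maximum_matching: "\<exists>M. matching G M \<and> card M = matching_number G"
proof -
  have "matching_number G \<in> {card M | M. matching G M}" unfolding matching_number_def
  proof (rule Max_in)
    have "{card M | M. matching G M} \<subseteq> card ` Pow (edges G)" by (auto simp: matching_def)
    then show "finite {card M | M. matching G M}" using finite_edges finite_subset by blast
    have "matching G {}" by (simp add: matching_def)
    then show "{card M | M. matching G M} \<noteq> {}" by blast
  qed
  then show ?thesis by auto
qed

end

section \<open>The lower bound\<close>

text \<open>In both parities the excess over the extremal value is a nonnegative combination of the slacks
  \<open>e\<close>, \<open>l\<close>, \<open>q\<close> of the bounds on \<open>B\<close>, \<open>L\<close>, \<open>Q\<close>, plus a multiple of \<open>m - 1\<close> or \<open>m - 2\<close>. For even \<open>g\<close>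
  that multiple is negative at \<open>m = 1\<close>, where parity forces \<open>l \<ge> 1\<close> instead.\<close>

lemma weighted_bound_odd:
  fixes n N g \<beta> B L Q m B' L' :: int
  assumes n: "n = N + g" "3 \<le> g" "3 * g \<le> n" and m: "1 \<le> m" "m \<le> g"
    and B: "2 * (n - 2) * N \<le> B + L * (n - 3)"
    and Q: "N * N \<le> Q + m + 2 * (N - m) + (N - m) * (N - m)"
    and L: "2 * L + g + 2 * \<beta> \<le> 2 * n + m"
    and B': "B' + L' * (n - 3) = 2 * (n - 2) * N"
    and L': "2 * L' + g + 2 * \<beta> = 2 * n + 1"
  shows "2 * B' \<le> 2 * B + Q"
    and "2 * B + Q = 2 * B' \<Longrightarrow> B + L * (n - 3) = 2 * (n - 2) * N \<and> L = L' \<and> Q = 0 \<and> m = 1"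
proof -
  define e where "e = B + L * (n - 3) - 2 * (n - 2) * N"
  define l where "l = 2 * n + m - (2 * L + g + 2 * \<beta>)"
  define q where "q = Q - (m - 1) * (2 * N - m)"
  have nonneg: "0 \<le> e" "0 \<le> l" "0 \<le> q" using B L Q by (simp_all add: e_def l_def q_def algebra_simps)
  have L2: "2 * L = 2 * n + m - g - 2 * \<beta> - l" "2 * L' = 2 * n + 1 - g - 2 * \<beta>"
    using L' by (simp_all add: l_def)
  have "2 * B = 2 * e + 4 * (n - 2) * N - (2 * L) * (n - 3)" by (simp add: e_def algebra_simps)
  moreover have "2 * B' = 4 * (n - 2) * N - (2 * L') * (n - 3)" using B' by (simp add: algebra_simps)
  ultimately have id: "2 * B + Q - 2 * B' = 2 * e + l * (n - 3) + q + (m - 1) * (n - 2 * g - m + 3)"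
    unfolding L2 using n(1) by (simp add: q_def algebra_simps)
  \<comment> \<open>Since m <= g and 3 g <= n, the factor n - 2 g - m + 3 is at least 3; in the
    equality case the vanishing product therefore gives m = 1.\<close>
  have ln: "0 \<le> l * (n - 3)" and mn: "0 \<le> (m - 1) * (n - 2 * g - m + 3)"
    using nonneg n m by simp_all
  then show "2 * B' \<le> 2 * B + Q" using id nonneg by linarith
  assume "2 * B + Q = 2 * B'"
  then have z: "e = 0" "l * (n - 3) = 0" "q = 0" "(m - 1) * (n - 2 * g - m + 3) = 0"
    using id nonneg ln mn by linarith+
  then have "m = 1" "l = 0" using n m by auto
  then show "B + L * (n - 3) = 2 * (n - 2) * N \<and> L = L' \<and> Q = 0 \<and> m = 1"
    using z L2 by (simp add: e_def q_def)
qed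

lemma weighted_bound_even:
  fixes n N g \<beta> B L Q m B' L' Q' :: int
  assumes n: "n = N + g" "3 \<le> g" "3 * g \<le> n" and m: "1 \<le> m" "m \<le> g" and ev: "even g"
    and B: "2 * (n - 2) * N \<le> B + L * (n - 3)"
    and Q: "N * N \<le> Q + m + 2 * (N - m) + (N - m) * (N - m)"
    and L: "2 * L + g + 2 * \<beta> \<le> 2 * n + m"
    and B': "B' + L' * (n - 3) = 2 * (n - 2) * N"
    and L': "2 * L' + g + 2 * \<beta> = 2 * n + 2"
    and Q': "Q' = 2 * (N - 1)"
  shows "2 * B' + Q' \<le> 2 * B + Q"
    and "2 * B + Q = 2 * B' + Q' \<Longrightarrow> B + L * (n - 3) = 2 * (n - 2) * N \<and> L = L' \<and> Q = Q' \<and> m = 2"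
proof -
  define e where "e = B + L * (n - 3) - 2 * (n - 2) * N"
  define l where "l = 2 * n + m - (2 * L + g + 2 * \<beta>)"
  define q where "q = Q - (m - 1) * (2 * N - m)"
  have nonneg: "0 \<le> e" "0 \<le> l" "0 \<le> q" using B L Q by (simp_all add: e_def l_def q_def algebra_simps)
  have L2: "2 * L = 2 * n + m - g - 2 * \<beta> - l" "2 * L' = 2 * n + 2 - g - 2 * \<beta>"
    using L' by (simp_all add: l_def)
  have "2 * B = 2 * e + 4 * (n - 2) * N - (2 * L) * (n - 3)" by (simp add: e_def algebra_simps)
  moreover have "2 * B' = 4 * (n - 2) * N - (2 * L') * (n - 3)" using B' by (simp add: algebra_simps)
  ultimately have id: "2 * B + Q - (2 * B' + Q') = 2 * e + l * (n - 3) + q + (m - 2) * (n - 2 * g - m + 2)"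
    unfolding L2 Q' using n(1) by (simp add: q_def algebra_simps)
  have ln: "0 \<le> l * (n - 3)" using nonneg n by simp
  show "2 * B' + Q' \<le> 2 * B + Q"
    and "2 * B + Q = 2 * B' + Q' \<Longrightarrow> B + L * (n - 3) = 2 * (n - 2) * N \<and> L = L' \<and> Q = Q' \<and> m = 2"
  proof (atomize (full), cases "m = 1")
    case True
    then have "odd l" using ev by (simp add: l_def)
    then have "1 \<le> l" using nonneg by (cases "l = 0") auto
    then have "0 \<le> (l - 1) * (n - 3)" using n(2,3) by simp
    then have "n - 3 \<le> l * (n - 3)" by (simp add: algebra_simps)
    moreover have "(m - 2) * (n - 2 * g - m + 2) = 2 * g - 1 - n" unfolding True by simp
    \<comment> \<open>The two terms add up to at least (n - 3) + (2 g - 1 - n) = 2 g - 4 >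
      0.\<close>
    ultimately have "2 * B + Q > 2 * B' + Q'" using id nonneg n(2) by linarith
    then show "2 * B' + Q' \<le> 2 * B + Q \<and> (2 * B + Q = 2 * B' + Q' \<longrightarrow>
      B + L * (n - 3) = 2 * (n - 2) * N \<and> L = L' \<and> Q = Q' \<and> m = 2)" by simp
  next
    case False
    then have mn: "0 \<le> (m - 2) * (n - 2 * g - m + 2)"
      using n m by (intro mult_nonneg_nonneg) linarith+
    have "B + L * (n - 3) = 2 * (n - 2) * N \<and> L = L' \<and> Q = Q' \<and> m = 2" if "2 * B + Q = 2 * B' + Q'"
    proof -
      have z: "e = 0" "l * (n - 3) = 0" "q = 0" "(m - 2) * (n - 2 * g - m + 2) = 0"
        using that id nonneg ln mn by linarith+
      then have "m = 2" "l = 0" using n m by auto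
      then show ?thesis using z L2 by (simp add: e_def q_def Q')
    qed
    then show "2 * B' + Q' \<le> 2 * B + Q \<and> (2 * B + Q = 2 * B' + Q' \<longrightarrow>
      B + L * (n - 3) = 2 * (n - 2) * N \<and> L = L' \<and> Q = Q' \<and> m = 2)"
      using id nonneg ln mn by linarith
  qed
qed

context rooted_unicycle
begin

text \<open>The primed numbers stand for the data of the extremal graph, so that the comparison does
  not involve its structure. The estimates are carried to the integers, where differences such as N
  - m do not truncate.\<close>

lemma wiener_bound:
  fixes W' B' L' Q' :: nat
  defines "n \<equiv> card (verts G)" and "N \<equiv> card T" and "\<beta> \<equiv> matching_number G"
  assumes \<beta>: "3 * g \<le> 2 * \<beta>"
    and W': "2 * W' = 2 * B' + (\<Sum>i<g. \<Sum>j<g. cdist g i j) + 2 * N * (\<Sum>j<g. cdist g 0 j) + Q'"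
    and B': "B' + L' * (n - 3) = 2 * (n - 2) * N"
    and odd: "odd g \<Longrightarrow> 2 * L' + g + 2 * \<beta> = 2 * n + 1 \<and> Q' = 0"
    and even: "even g \<Longrightarrow> 2 * L' + g + 2 * \<beta> = 2 * n + 2 \<and> Q' = 2 * (N - 1)"
  shows "W' \<le> wiener G"
    and "wiener G = W' \<Longrightarrow> (\<forall>z\<in>T. sub z \<le> 2) \<and> card leaves = L' \<and> root_sum = Q' \<and>
      card (root ` T) = (if odd g then 1 else 2)"
proof -
  let ?m = "card (root ` T)"
  obtain M where "matching G M" "card M = \<beta>" using ex_maximum_matching \<beta>_def by blast
  then have M: "2 * \<beta> \<le> n" "2 * card leaves + g + 2 * \<beta> \<le> 2 * n + ?m"
    using card_leaves_le unfolding n_def by blast+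
  have n: "n = N + g" "3 * g \<le> n" using card_verts M \<beta> by (simp_all add: n_def N_def)
  then have N: "1 \<le> N" using g_ge_3 by simp
  have m: "?m \<le> N" "N * N \<le> root_sum + ?m + 2 * (N - ?m) + (N - ?m) * (N - ?m)"
    using root_sum_ge by (simp_all add: N_def)
  have "root ` T \<subseteq> {..<g}" using T_verts by auto
  then have mg: "?m \<le> g" using card_mono[of "{..<g}"] by fastforce
  have m1: "1 \<le> ?m" using N unfolding N_def by (auto simp: Suc_le_eq card_gt_0_iff)
  \<comment> \<open>The cycle terms on both sides depend only on \<open>g\<close> and
    \<open>N\<close> and cancel.\<close>
  have W: "2 * wiener G + 2 * B' + Q' = 2 * W' + 2 * bridge_sum + root_sum"
    using two_wiener_eq W' by (simp add: N_def)
  have int3: "int (n - 3) = int n - 3" "int (n - 2) = int n - 2" "int (N - ?m) = int N - int ?m"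
    "int (N - 1) = int N - 1"
    using n g_ge_3 m N by auto
  have B: "2 * (int n - 2) * int N \<le> int bridge_sum + int (card leaves) * (int n - 3)"
    using bridge_sum_ge[folded n_def N_def, folded of_nat_le_iff[where 'a = int]]
    by (simp only: of_nat_add of_nat_mult of_nat_numeral int3)
  have B'': "int B' + int L' * (int n - 3) = 2 * (int n - 2) * int N"
    using B'[folded of_nat_eq_iff[where 'a = int]] by (simp only: of_nat_add of_nat_mult of_nat_numeral int3)
  have Q: "int N * int N \<le> int root_sum + int ?m + 2 * (int N - int ?m) + (int N - int ?m) * (int N - int ?m)"
    using m(2)[folded of_nat_le_iff[where 'a = int]] by (simp only: of_nat_add of_nat_mult of_nat_numeral int3)
  have L: "2 * int (card leaves) + int g + 2 * int \<beta> \<le> 2 * int n + int ?m" using M(2) by linarith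
  have gn: "int n = int N + int g" "3 \<le> int g" "3 * int g \<le> int n" "1 \<le> int ?m" "int ?m \<le> int g"
    using n g_ge_3 m1 mg by linarith+
  have lift_eq: "bridge_sum + card leaves * (n - 3) = 2 * (n - 2) * N"
    if "int bridge_sum + int (card leaves) * (int n - 3) = 2 * (int n - 2) * int N"
    using that unfolding of_nat_eq_iff[where 'a = int, symmetric]
    by (simp only: of_nat_add of_nat_mult of_nat_numeral int3)
  have *: "2 * B' + Q' \<le> 2 * bridge_sum + root_sum \<and> (2 * bridge_sum + root_sum = 2 * B' + Q' \<longrightarrow>
     bridge_sum + card leaves * (n - 3) = 2 * (n - 2) * N \<and> card leaves = L' \<and> root_sum = Q' \<and>
      ?m = (if odd g then 1 else 2))"
  proof (cases "odd g")
    case True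
    have L': "2 * int L' + int g + 2 * int \<beta> = 2 * int n + 1" "Q' = 0" using odd[OF True] by linarith+
    note b = weighted_bound_odd[OF gn B Q L B'' L'(1)]
    show ?thesis using b(1) b(2) lift_eq True L'(2) by auto
  next
    case False
    have L': "2 * int L' + int g + 2 * int \<beta> = 2 * int n + 2" "int Q' = 2 * (int N - 1)"
      using even False N by auto
    have "Parity.even (int g)" using False by simp
    note b = weighted_bound_even[OF gn this B Q L B'' L']
    show ?thesis using b(1) b(2) lift_eq False by auto
  qed
  then show "W' \<le> wiener G" using W by linarith
  assume "wiener G = W'"
  then have "2 * bridge_sum + root_sum = 2 * B' + Q'" using W by linarith
  with * show "(\<forall>z\<in>T. sub z \<le> 2) \<and> card leaves = L' \<and> root_sum = Q' \<and>
      card (root ` T) = (if odd g then 1 else 2)"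
    using bridge_sum_eq_iff unfolding n_def N_def by blast
qed

end

section \<open>Unicyclic graphs\<close>

text \<open>When the new first vertex already lies on the path, the part before its occurrence is
  cut off.\<close>

lemma rtrancl_distinct_path:
  assumes "(x, y) \<in> R\<^sup>*"
  shows "\<exists>p. p \<noteq> [] \<and> hd p = x \<and> last p = y \<and> distinct p \<and> successively (\<lambda>u v. (u, v) \<in> R) p"
  using assms
proof (induction rule: converse_rtrancl_induct)
  case base
  show ?case by (intro exI[of _ "[y]"]) simp
next
  case (step x z)
  then obtain p where p: "p \<noteq> []" "hd p = z" "last p = y" "distinct p"
    "successively (\<lambda>u v. (u, v) \<in> R) p" by blast
  show ?case
  proof (cases "x \<in> set p")
    case True
    then obtain p1 p2 where "p = p1 @ x # p2" by (meson split_list)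
    then show ?thesis using p by (intro exI[of _ "x # p2"]) (auto simp: successively_append_iff)
  next
    case False
    then show ?thesis using p step by (intro exI[of _ "x # p"]) (auto simp: successively_Cons)
  qed
qed

text \<open>This produces the second cycle that contradicts uniqueness when an unexpected edge is
  present.\<close>

lemma is_cycle_of_path:
  assumes G: "simple_graph G" and p: "distinct p" "3 \<le> length p" "successively (\<lambda>u v. {u, v} \<in> edges G) p"
    and e: "{last p, hd p} \<in> edges G"
  shows "is_cycle G \<lparr>verts = set p, edges = (\<lambda>i. {p ! i, p ! (Suc i mod length p)}) ` {..<length p}\<rparr>"
    (is "is_cycle G ?C")
proof -
  let ?k = "length p"
  have mod: "Suc i mod ?k < ?k" for i using p(2) by (intro mod_less_divisor) linarith
  have ne: "p ! i \<noteq> p ! (Suc i mod ?k)" if "i < ?k" for i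
    using that p(1,2) mod[of i] by (subst nth_eq_iff_index_eq) (auto simp: Suc_mod_eq)
  have edge: "{p ! i, p ! (Suc i mod ?k)} \<in> edges G" if "i < ?k" for i
  proof (cases "Suc i = ?k")
    case True
    moreover have "p \<noteq> []" using p(2) by auto
    ultimately have "last p = p ! i" "hd p = p ! 0"
      using last_conv_nth[of p] hd_conv_nth[of p] by (simp_all flip: True)
    then show ?thesis using e True by simp
  next
    case False
    then show ?thesis using p(3) that by (simp add: successively_conv_nth)
  qed
  have sub: "e \<subseteq> verts G" if "e \<in> edges G" for e using G that by (simp add: simple_graph_def)
  have "set p \<subseteq> verts G"
  proof
    fix v assume "v \<in> set p"
    then obtain i where "i < ?k" "v = p ! i" by (auto simp: in_set_conv_nth)
    then show "v \<in> verts G" using sub[OF edge[of i]] by simp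
  qed
  moreover have "simple_graph ?C"
    unfolding simple_graph_def using ne mod by auto
  ultimately have "subgraph ?C G" unfolding subgraph_def using edge by auto
  moreover have "isomorphic (cycle_graph ?k) ?C"
    unfolding isomorphic_def
  proof (intro exI[of _ "(!) p"] conjI ballI)
    show "bij_betw ((!) p) (verts (cycle_graph ?k)) (verts ?C)"
      using p(1) by (simp add: cycle_graph_def bij_betw_nth)
    fix u v assume uv: "u \<in> verts (cycle_graph ?k)" "v \<in> verts (cycle_graph ?k)"
    have inj: "p ! i = p ! j \<longleftrightarrow> i = j" if "i < ?k" "j < ?k" for i j
      using p(1) that by (simp add: nth_eq_iff_index_eq)
    have "{u, v} = {i, Suc i mod ?k} \<longleftrightarrow> {p ! u, p ! v} = {p ! i, p ! (Suc i mod ?k)}" if "i < ?k" for i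
      using uv that mod[of i] by (simp add: cycle_graph_def doubleton_eq_iff inj)
    then show "({u, v} \<in> edges (cycle_graph ?k)) = ({p ! u, p ! v} \<in> edges ?C)"
      by (auto simp: cycle_graph_def image_iff)
  qed
  ultimately show ?thesis unfolding is_cycle_def using isomorphic_sym p(2) by blast
qed

lemma is_cycle_indexing:
  assumes "is_cycle G C"
  obtains c k where "k = card (edges C)" "3 \<le> k" "inj_on c {..<k}" "verts C = c ` {..<k}"
    "edges C = (\<lambda>i. {c i, c (Suc i mod k)}) ` {..<k}"
proof -
  obtain k where k: "3 \<le> k" and iso: "isomorphic C (cycle_graph k)" and C: "simple_graph C"
    using assms unfolding is_cycle_def subgraph_def by blast
  obtain c where c: "bij_betw c {..<k} (verts C)"
    and e: "\<forall>u<k. \<forall>v<k. {u, v} \<in> edges (cycle_graph k) \<longleftrightarrow> {c u, c v} \<in> edges C"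
    using isomorphic_sym[OF iso] unfolding isomorphic_def by (auto simp: cycle_graph_def)
  have inj: "inj_on c {..<k}" and im: "verts C = c ` {..<k}" using c by (auto simp: bij_betw_def)
  have mod: "Suc i mod k < k" for i using k by simp
  have edges: "edges C = (\<lambda>i. {c i, c (Suc i mod k)}) ` {..<k}"
  proof
    show "edges C \<subseteq> (\<lambda>i. {c i, c (Suc i mod k)}) ` {..<k}"
    proof
      fix f assume f: "f \<in> edges C"
      then obtain x y where "f = {x, y}" "x \<in> verts C" "y \<in> verts C"
        using C by (auto simp: simple_graph_def card_2_iff)
      then obtain u v where uv: "f = {c u, c v}" "u < k" "v < k" by (auto simp: im)
      then have "{u, v} \<in> edges (cycle_graph k)" using e f by blast
      then obtain i where "i < k" "{u, v} = {i, Suc i mod k}" by (auto simp: cycle_graph_def)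
      moreover have "f = c ` {u, v}" by (simp add: uv)
      ultimately show "f \<in> (\<lambda>i. {c i, c (Suc i mod k)}) ` {..<k}" by auto
    qed
    have "{i, Suc i mod k} \<in> edges (cycle_graph k)" if "i < k" for i
      using that by (auto simp: cycle_graph_def)
    then show "(\<lambda>i. {c i, c (Suc i mod k)}) ` {..<k} \<subseteq> edges C" using e mod by blast
  qed
  have "inj_on (\<lambda>i. {c i, c (Suc i mod k)}) {..<k}"
  proof (rule inj_onI)
    fix i j assume ij: "i \<in> {..<k}" "j \<in> {..<k}" and eq: "{c i, c (Suc i mod k)} = {c j, c (Suc j mod k)}"
    have "c x = c y \<longleftrightarrow> x = y" if "x < k" "y < k" for x y using inj that by (auto simp: inj_on_def)
    \<comment> \<open>The second alternative would make i and j successors of each other, which is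
      impossible on a cycle of length at least 3.\<close>
    then have "i = j \<or> i = Suc j mod k \<and> j = Suc i mod k" using eq ij mod by (auto simp: doubleton_eq_iff)
    then show "i = j" using k ij by (auto simp: Suc_mod_eq split: if_splits)
  qed
  then have "k = card (edges C)" by (simp add: edges card_image)
  then show thesis using that k inj im edges by blast
qed

text \<open>The parent of a vertex off the cycle is a neighbour one step nearer to the cycle.
  Uniqueness of the cycle then excludes all edges other than cycle edges and parent edges.\<close>

lemma unicyclic_rooted:
  assumes "unicyclic G"
  obtains c par h where "rooted_unicycle G (girth G) c par h"
proof -
  have sg: "simple_graph G" and conn: "connected_graph G" and ex1: "\<exists>!C. is_cycle G C"
    using assms by (auto simp: unicyclic_def)
  define C where "C = (THE C. is_cycle G C)"
  have C: "is_cycle G C" unfolding C_def using ex1 by (rule theI')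
  have uniq: "D = C" if "is_cycle G D" for D using ex1 C that by blast
  obtain c g where g: "g = card (edges C)" "3 \<le> g" and inj: "inj_on c {..<g}"
    and vC: "verts C = c ` {..<g}" and eC: "edges C = (\<lambda>i. {c i, c (Suc i mod g)}) ` {..<g}"
    by (rule is_cycle_indexing[OF C])
  have girth: "girth G = g" by (simp add: girth_def C_def g(1))
  have sub: "verts C \<subseteq> verts G" "edges C \<subseteq> edges G" using C by (auto simp: is_cycle_def subgraph_def)
  \<comment> \<open>\<open>P v k\<close> asks for a walk of length k from \<open>v\<close> to the
    cycle, so \<open>h\<close> is the distance to the cycle.\<close>
  define P where "P v k \<longleftrightarrow> (\<exists>p w. w \<in> verts C \<and> walk G v p w \<and> length p = Suc k)" for v k
  define h where "h v = (LEAST k. P v k)" for v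
  have ex: "\<exists>k. P v k" if "v \<in> verts G" for v
  proof -
    have c0: "c 0 \<in> verts C" using g vC by auto
    then have "c 0 \<in> verts G" using sub(1) by blast
    then have "\<exists>p. walk G v p (c 0)" using conn that by (simp add: connected_graph_def)
    then obtain p where p: "walk G v p (c 0)" ..
    then have "length p = Suc (length p - 1)" by (cases p) (auto simp: walk_def)
    with c0 p show ?thesis unfolding P_def by blast
  qed
  have "\<exists>w\<in>verts G. {v, w} \<in> edges G \<and> h w < h v" if v: "v \<in> verts G - c ` {..<g}" for v
  proof -
    have "P v (h v)" unfolding h_def using ex v by (metis DiffD1 LeastI_ex)
    then obtain p w where p: "w \<in> verts C" "walk G v p w" "length p = Suc (h v)" unfolding P_def by blast
    from p(2) obtain q where q: "p = v # q" by (cases p) (auto simp: walk_def)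
    have "q \<noteq> []" using p q v vC by (auto simp: walk_Cons)
    then have e: "{v, hd q} \<in> edges G" "walk G (hd q) q w" using p(2) q by (auto simp: walk_Cons)
    have hq: "hd q \<in> verts G" using e(2) by (cases q) (auto simp: walk_def)
    obtain k where k: "h v = Suc k" using p(3) q \<open>q \<noteq> []\<close> by (cases "h v") auto
    have "P (hd q) k" unfolding P_def using e(2) p q k by auto
    then have "h (hd q) \<le> k" unfolding h_def by (rule Least_le)
    then show ?thesis using e hq k by (intro bexI[of _ "hd q"]) auto
  qed
  then obtain par where par: "\<And>v. v \<in> verts G - c ` {..<g} \<Longrightarrow>
      par v \<in> verts G \<and> {v, par v} \<in> edges G \<and> h (par v) < h v" by metis
  let ?E = "edges C \<union> (\<lambda>v. {v, par v}) ` (verts G - c ` {..<g})"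
  \<comment> \<open>The candidate edges \<open>?E\<close> already connect every vertex to
    \<open>c 0\<close>, so an edge outside them would close a path in \<open>?E\<close> to a new
    cycle.\<close>
  define R where "R = {(u, v). {u, v} \<in> ?E}"
  have symR: "sym R" unfolding R_def by (auto intro!: symI simp: insert_commute)
  have c0: "(c i, c 0) \<in> R\<^sup>*" if "i < g" for i
    using that
  proof (induction i)
    case (Suc i)
    then have "{c i, c (Suc i)} \<in> ?E" unfolding eC by (force simp: Suc_mod_eq)
    then have "(c (Suc i), c i) \<in> R" by (simp add: R_def insert_commute)
    then show ?case using Suc by (simp add: converse_rtrancl_into_rtrancl)
  qed simp
  have v0: "(v, c 0) \<in> R\<^sup>*" if "v \<in> verts G" for v
    using that
  proof (induction "h v" arbitrary: v rule: less_induct)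
    case less
    show ?case
    proof (cases "v \<in> c ` {..<g}")
      case True
      then show ?thesis using c0 by auto
    next
      case False
      then have "(v, par v) \<in> R" using less.prems by (simp add: R_def)
      moreover have "(par v, c 0) \<in> R\<^sup>*" using less par False by blast
      ultimately show ?thesis by (rule converse_rtrancl_into_rtrancl)
    qed
  qed
  have EG: "?E \<subseteq> edges G" using sub par by blast
  have "edges G \<subseteq> ?E"
  proof (rule ccontr)
    assume "\<not> edges G \<subseteq> ?E"
    then obtain e where e: "e \<in> edges G" "e \<notin> ?E" by blast
    then obtain x y where xy: "e = {x, y}" "x \<noteq> y" "x \<in> verts G" "y \<in> verts G"
      using sg by (auto simp: simple_graph_def card_2_iff)
    have "(c 0, y) \<in> R\<^sup>*" using v0[OF xy(4)] sym_rtrancl[OF symR] by (auto dest: symD)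
    then have "(x, y) \<in> R\<^sup>*" using v0[OF xy(3)] by simp
    then obtain p where p: "p \<noteq> []" "hd p = x" "last p = y" "distinct p"
      "successively (\<lambda>u v. (u, v) \<in> R) p" using rtrancl_distinct_path by metis
    have succ: "successively (\<lambda>u v. {u, v} \<in> edges G) p"
      using p(5) by (rule successively_mono) (use EG in \<open>auto simp: R_def\<close>)
    \<comment> \<open>With one vertex the ends would coincide; with two, \<open>e\<close> itself
      would lie in \<open>?E\<close>.\<close>
    have len: "3 \<le> length p"
    proof (rule ccontr)
      assume "\<not> 3 \<le> length p"
      then consider a where "p = [a]" | a b where "p = [a, b]"
        using p(1) by (cases p; cases "tl p"; cases "tl (tl p)") auto
      then show False using p e xy by cases (auto simp: R_def)
    qed
    let ?D = "\<lparr>verts = set p, edges = (\<lambda>i. {p ! i, p ! (Suc i mod length p)}) ` {..<length p}\<rparr>"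
    have "is_cycle G ?D" using p xy e len succ by (intro is_cycle_of_path[OF sg]) (auto simp: insert_commute)
    then have "?D = C" by (rule uniq)
    \<comment> \<open>The last edge of the new cycle is \<open>e\<close>, so by uniqueness
      \<open>e\<close> would belong to \<open>C\<close>.\<close>
    moreover have "{p ! (length p - 1), p ! (Suc (length p - 1) mod length p)} \<in> edges ?D"
      unfolding ugraph.simps by (rule imageI) (use p(1) in simp)
    moreover have "{p ! (length p - 1), p ! (Suc (length p - 1) mod length p)} = e"
      using last_conv_nth[OF p(1)] hd_conv_nth[OF p(1)] p(1-3) xy(1) by (simp add: insert_commute)
    ultimately show False using e by auto
  qed
  then have EG': "edges G = ?E" using EG by blast
  have "rooted_unicycle G g c par h"
  proof
    show "finite (verts G)" using sg by (simp add: simple_graph_def)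
    show "c ` {..<g} \<subseteq> verts G" using sub vC by simp
    show "edges G = (\<lambda>i. {c i, c (Suc i mod g)}) ` {..<g} \<union> (\<lambda>v. {v, par v}) ` (verts G - c ` {..<g})"
      using EG' unfolding eC .
  qed (use g inj par in blast)+
  then show thesis using that girth by blast
qed

section \<open>The extremal graph\<close>

lemma isomorphicI_image:
  assumes f: "bij_betw f (verts G) (verts H)"
    and G: "\<And>e. e \<in> edges G \<Longrightarrow> e \<subseteq> verts G"
    and E: "edges H = (`) f ` edges G"
  shows "isomorphic G H"
  unfolding isomorphic_def
proof (intro exI[of _ f] conjI ballI f)
  fix u v assume uv: "u \<in> verts G" "v \<in> verts G"
  have inj: "inj_on f (verts G)" using f by (simp add: bij_betw_def)
  show "({u, v} \<in> edges G) = ({f u, f v} \<in> edges H)"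
  proof
    assume "{u, v} \<in> edges G"
    then have "f ` {u, v} \<in> edges H" unfolding E by (rule imageI)
    then show "{f u, f v} \<in> edges H" by simp
  next
    assume "{f u, f v} \<in> edges H"
    then obtain e where e: "e \<in> edges G" "f ` {u, v} = f ` e" unfolding E by auto
    have "{u, v} \<subseteq> verts G" using uv by simp
    then have "{u, v} = e" using inj_on_image_eq_iff[OF inj _ G[OF e(1)]] e(2) by blast
    then show "{u, v} \<in> edges G" using e by simp
  qed
qed

text \<open>The last clause is meant for the \<open>Near\<close> vertices, which hang directly from
  \<open>Cyc 0\<close>.\<close>

fun star_par :: "g_vertex \<Rightarrow> g_vertex" where
  "star_par (Tree (Far i)) = Tree (Near i)"
| "star_par Extra = Cyc 1"
| "star_par _ = Cyc 0"

fun star_height :: "g_vertex \<Rightarrow> nat" where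
  "star_height (Cyc i) = 0"
| "star_height (Tree (Far i)) = 2"
| "star_height _ = 1"

text \<open>The \<open>Near\<close> vertices come in two blocks, those carrying a \<open>Far\<close>
  vertex and those that are leaves, so that a bijection can be assembled block by block.\<close>

definition star_tree :: "nat \<Rightarrow> nat \<Rightarrow> bool \<Rightarrow> g_vertex set" where
  "star_tree a b ex = (\<lambda>i. Tree (Near i)) ` {..<a} \<union> (\<lambda>i. Tree (Near i)) ` {a..<a + b}
    \<union> (\<lambda>i. Tree (Far i)) ` {..<a} \<union> (if ex then {Extra} else {})"

text \<open>A common form for both parities: \<open>ex\<close> tells whether the pendant vertex
  \<open>Extra\<close> is present.\<close>

definition star_graph :: "nat \<Rightarrow> nat \<Rightarrow> nat \<Rightarrow> bool \<Rightarrow> g_vertex ugraph" where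
  "star_graph g a b ex = \<lparr>verts = Cyc ` {..<g} \<union> star_tree a b ex,
     edges = (\<lambda>i. {Cyc i, Cyc (Suc i mod g)}) ` {..<g} \<union> (\<lambda>v. {v, star_par v}) ` star_tree a b ex\<rparr>"

lemma star_graph_sel [simp]:
  "verts (star_graph g a b ex) = Cyc ` {..<g} \<union> star_tree a b ex"
  "edges (star_graph g a b ex) =
    (\<lambda>i. {Cyc i, Cyc (Suc i mod g)}) ` {..<g} \<union> (\<lambda>v. {v, star_par v}) ` star_tree a b ex"
  by (simp_all add: star_graph_def)

lemma star_tree_minus [simp]: "Cyc ` A \<union> star_tree a b ex - Cyc ` A = star_tree a b ex"
  by (auto simp: star_tree_def)

lemma finite_star_tree [simp]: "finite (star_tree a b ex)"
  by (simp add: star_tree_def)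

lemma cycle_with_tree_eq:
  assumes "3 \<le> g"
  shows "cycle_with_tree g (T_star a b) = star_graph g a b False"
proof -
  have near: "{..<a + b} = {..<a} \<union> {a..<a + b}" by auto
  have "glue ` verts (T_star a b) = insert (Cyc 0) (star_tree a b False)"
    unfolding T_star_def ugraph.simps near image_Un image_image star_tree_def by (simp add: glue_def)
  moreover have "Cyc 0 \<in> Cyc ` {..<g}" using assms by auto
  ultimately have "verts (cycle_with_tree g (T_star a b)) = verts (star_graph g a b False)"
    by (auto simp: cycle_with_tree_def cycle_graph_def)
  moreover have "(`) glue ` edges (T_star a b) = (\<lambda>v. {v, star_par v}) ` star_tree a b False"
    unfolding T_star_def ugraph.simps near image_Un image_image star_tree_def
    by (simp add: glue_def insert_commute)
  then have "edges (cycle_with_tree g (T_star a b)) = edges (star_graph g a b False)"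
    by (simp add: cycle_with_tree_def cycle_graph_def image_image)
  ultimately show ?thesis by simp
qed

lemma G_star_eq:
  assumes "3 \<le> g"
  shows "G_star n g \<beta> =
    star_graph g (if odd g then \<beta> - (g + 1) div 2 else \<beta> - g div 2 - 1) (n - 2 * \<beta> + 1) (even g)"
proof -
  have "star_tree a b True = insert Extra (star_tree a b False)" for a b by (simp add: star_tree_def)
  then have "star_graph g a b True =
      \<lparr>verts = verts (star_graph g a b False) \<union> {Extra}, edges = edges (star_graph g a b False) \<union> {{Cyc 1, Extra}}\<rparr>" for a b
    unfolding star_graph_def ugraph.simps by (simp add: insert_commute)
  then show ?thesis unfolding G_star_def cycle_with_tree_eq[OF assms] Let_def by simp
qed

lemma star_graph_rooted:
  assumes "3 \<le> g"
  shows "rooted_unicycle (star_graph g a b ex) g Cyc star_par star_height"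
proof
  show "star_par v \<in> verts (star_graph g a b ex)" "star_height (star_par v) < star_height v"
    if "v \<in> verts (star_graph g a b ex) - Cyc ` {..<g}" for v
    using that assms by (auto simp: star_tree_def split: if_splits)
qed (use assms in \<open>auto simp: inj_on_def\<close>)

lemma star_tree_iff [simp]:
  "Tree (Near i) \<in> star_tree a b ex \<longleftrightarrow> i < a + b"
  "Tree (Far i) \<in> star_tree a b ex \<longleftrightarrow> i < a"
  "Extra \<in> star_tree a b ex \<longleftrightarrow> ex"
  "Cyc i \<notin> star_tree a b ex" "Tree Root \<notin> star_tree a b ex"
  by (auto simp: star_tree_def image_iff)

lemma g_vertex_cases:
  obtains i where "v = Cyc i" | "v = Tree Root" | i where "v = Tree (Near i)"
    | i where "v = Tree (Far i)" | "v = Extra"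
  by (metis g_vertex.exhaust tree_vertex.exhaust)

text \<open>\<open>B\<close> is the bridge sum of the extremal graph. No tree vertex has
  \<open>sub\<close> above 2, so the bridge estimate holds with equality.\<close>

lemma star_graph_wiener:
  fixes a b g :: nat and ex :: bool
  defines "N \<equiv> 2 * a + b + of_bool ex" and "L \<equiv> a + b + of_bool ex"
  assumes g: "3 \<le> g"
  shows "\<exists>B. B + L * (N + g - 3) = 2 * (N + g - 2) * N \<and>
    2 * wiener (star_graph g a b ex) = 2 * B + (\<Sum>i<g. \<Sum>j<g. cdist g i j)
      + 2 * N * (\<Sum>j<g. cdist g 0 j) + (if ex then 2 * (N - 1) else 0)"
proof -
  interpret S: rooted_unicycle "star_graph g a b ex" g Cyc star_par star_height
    by (rule star_graph_rooted[OF g])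
  have T: "S.T = star_tree a b ex" by (simp add: S.T_def)
  have c0: "0 < g" "1 < g" using g by auto
  have card_T: "card S.T = N"
    unfolding T star_tree_def N_def
    by (subst card_Un_disjoint; (subst card_Un_disjoint; (subst card_Un_disjoint)?)?)
      (auto simp: card_image inj_on_def)
  have near: "S.anc z (Tree (Near i)) \<longleftrightarrow> z = Tree (Near i) \<or> z = Cyc 0" if "i < a + b" for z i
  proof -
    have "Tree (Near i) \<in> S.T" using that by (simp add: T)
    then show ?thesis using S.anc_T[of "Tree (Near i)" z] c0 by simp
  qed
  have far: "S.anc z (Tree (Far i)) \<longleftrightarrow> z = Tree (Far i) \<or> z = Tree (Near i) \<or> z = Cyc 0" if "i < a" for z i
  proof -
    have "Tree (Far i) \<in> S.T" using that by (simp add: T)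
    then show ?thesis using S.anc_T[of "Tree (Far i)" z] near[of i] that by simp
  qed
  have extra: "S.anc z Extra \<longleftrightarrow> z = Extra \<or> z = Cyc 1" if "Extra \<in> star_tree a b ex" for z
    using S.anc_T[of Extra z] that c0 by (simp add: T del: star_tree_iff(3))
  have anc_cyc: "S.anc z (Cyc j) \<longleftrightarrow> z = Cyc j" if "Cyc j \<in> Cyc ` {..<g}" for z j
    using that by auto
  have sub_near: "S.sub (Tree (Near i)) = (if i < a then 2 else 1)" if "i < a + b" for i
  proof -
    have "v \<in> {v \<in> verts (star_graph g a b ex). S.anc (Tree (Near i)) v} \<longleftrightarrow>
        v \<in> (if i < a then {Tree (Near i), Tree (Far i)} else {Tree (Near i)})" for v
      using that by (cases v rule: g_vertex_cases) (auto simp: near far extra anc_cyc simp del: star_tree_iff(3))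
    then have "{v \<in> verts (star_graph g a b ex). S.anc (Tree (Near i)) v} =
        (if i < a then {Tree (Near i), Tree (Far i)} else {Tree (Near i)})" by blast
    then show ?thesis by (simp add: S.sub_def)
  qed
  have sub_far: "S.sub (Tree (Far i)) = 1" if "i < a" for i
  proof -
    have "v \<in> {v \<in> verts (star_graph g a b ex). S.anc (Tree (Far i)) v} \<longleftrightarrow> v \<in> {Tree (Far i)}" for v
      using that by (cases v rule: g_vertex_cases) (auto simp: near far extra anc_cyc simp del: star_tree_iff(3))
    then have "{v \<in> verts (star_graph g a b ex). S.anc (Tree (Far i)) v} = {Tree (Far i)}" by blast
    then show ?thesis by (simp add: S.sub_def)
  qed
  have sub_extra: "S.sub Extra = 1" if "Extra \<in> star_tree a b ex"
  proof -
    have "v \<in> {v \<in> verts (star_graph g a b ex). S.anc Extra v} \<longleftrightarrow> v \<in> {Extra}" for v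
      using that by (cases v rule: g_vertex_cases) (auto simp: near far extra anc_cyc simp del: star_tree_iff(3))
    then have "{v \<in> verts (star_graph g a b ex). S.anc Extra v} = {Extra}" by blast
    then show ?thesis by (simp add: S.sub_def)
  qed
  have "v \<in> S.leaves \<longleftrightarrow> v \<in> (\<lambda>i. Tree (Near i)) ` {a..<a + b} \<union> (\<lambda>i. Tree (Far i)) ` {..<a}
      \<union> star_tree a b ex \<inter> {Extra}" for v
    by (cases v rule: g_vertex_cases)
      (auto simp: S.leaves_def T sub_near sub_far sub_extra image_iff simp del: star_tree_iff(3) split: if_splits)
  then have "S.leaves = (\<lambda>i. Tree (Near i)) ` {a..<a + b} \<union> (\<lambda>i. Tree (Far i)) ` {..<a}
      \<union> star_tree a b ex \<inter> {Extra}" by blast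
  moreover have "card (star_tree a b ex \<inter> {Extra}) = of_bool ex" by (cases ex) simp_all
  ultimately have leaves: "card S.leaves = L"
    unfolding L_def by (simp only:) (subst card_Un_disjoint; (subst card_Un_disjoint)?;
      auto simp: card_image inj_on_def)
  have le2: "\<forall>z\<in>S.T. S.sub z \<le> 2"
  proof
    fix z assume "z \<in> S.T"
    then show "S.sub z \<le> 2"
      by (cases z rule: g_vertex_cases) (auto simp: T sub_near sub_far sub_extra simp del: star_tree_iff(3))
  qed
  have n: "card (verts (star_graph g a b ex)) = N + g" using S.card_verts card_T by simp
  have root0: "S.root v = 0" if "v \<in> S.T" "v \<noteq> Extra" for v
  proof (rule S.root_eqI[OF S.T_verts[OF that(1)] c0(1)])
    show "S.anc (Cyc 0) v"
      using that by (cases v rule: g_vertex_cases) (auto simp: T near far)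
  qed
  have root1: "S.root Extra = 1" if "Extra \<in> star_tree a b ex"
  proof (rule S.root_eqI)
    show "Extra \<in> verts (star_graph g a b ex)" using that by (simp del: star_tree_iff(3))
  qed (use c0 extra[OF that] in auto)
  have rs: "S.root_sum = (if ex then 2 * (N - 1) else 0)"
  proof (cases "Extra \<in> S.T")
    case False
    then have "S.root v = 0" if "v \<in> S.T" for v using root0 that by metis
    then have "S.root_sum = 0" by (simp add: S.root_sum_def)
    then show ?thesis using False unfolding T by simp
  next
    case True
    have one: "cdist g (Suc 0) 0 = 1" "cdist g 0 (Suc 0) = 1" using g by (simp_all add: cdist_def)
    \<comment> \<open>All roots but that of \<open>Extra\<close> are 0. Hence only pairs of
      \<open>Extra\<close> with one of the other N - 1 vertices count, each with distance 1 and in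
      both orders.\<close>
    have "S.root_sum = (\<Sum>u\<in>S.T - {Extra}. cdist g (S.root u) (S.root Extra))
        + (\<Sum>v\<in>S.T - {Extra}. cdist g (S.root Extra) (S.root v))
        + (\<Sum>u\<in>S.T - {Extra}. \<Sum>v\<in>S.T - {Extra}. cdist g (S.root u) (S.root v))"
      unfolding S.root_sum_def by (simp add: sum.remove[OF _ True] sum.distrib)
    also have "\<dots> = 2 * (N - 1)"
      using True by (simp add: root0 root1[folded T] one card_T)
    finally show ?thesis using True unfolding T by simp
  qed
  show ?thesis
    using S.two_wiener_eq S.bridge_sum_eq_iff le2 unfolding n leaves card_T rs by blast
qed

section \<open>The equality case\<close>

context rooted_unicycle
begin

text \<open>\<open>I\<close> becomes the \<open>Near\<close> vertices with a pendant vertex,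
  \<open>P\<close> the other ones, \<open>F\<close> the \<open>Far\<close> vertices and
  \<open>X\<close> the extra one. A vertex of \<open>F\<close> inherits the number of its parent, so
  the bijection commutes with the parent maps and carries edges to edges.\<close>

lemma isomorphic_star_graph:
  assumes T: "T = I \<union> P \<union> F \<union> X"
    and disj: "I \<inter> P = {}" "(I \<union> P) \<inter> F = {}" "(I \<union> P \<union> F) \<inter> X = {}"
    and par: "\<And>v. v \<in> I \<union> P \<Longrightarrow> par v = c 0" "\<And>v. v \<in> X \<Longrightarrow> par v = c 1"
    and F: "bij_betw par F I"
    and card: "card I = a" "card P = b" "card X = of_bool ex"
  shows "isomorphic G (star_graph g a b ex)"
proof -
  have fin: "finite I" "finite P" "finite F" "finite X" using finite_T unfolding T by simp_all
  obtain e where e: "bij_betw e I {..<a}" using finite_same_card_bij[of I "{..<a}"] fin card by auto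
  obtain e' where e': "bij_betw e' P {a..<a + b}" using finite_same_card_bij[of P "{a..<a + b}"] fin card by auto
  define f where "f v = (if v \<in> I then Tree (Near (e v)) else if v \<in> P then Tree (Near (e' v))
    else if v \<in> F then Tree (Far (e (par v))) else if v \<in> X then Extra else Cyc (root v))" for v
  have bT: "bij_betw f T (star_tree a b ex)"
    unfolding T star_tree_def
  proof (intro bij_betw_combine)
    have "bij_betw ((\<lambda>i. Tree (Near i)) \<circ> e) I ((\<lambda>i. Tree (Near i)) ` {..<a})"
      using e by (rule bij_betw_trans) (simp add: bij_betw_def inj_on_def)
    then show "bij_betw f I ((\<lambda>i. Tree (Near i)) ` {..<a})"
      by (subst bij_betw_cong) (auto simp: f_def)
    have "bij_betw ((\<lambda>i. Tree (Near i)) \<circ> e') P ((\<lambda>i. Tree (Near i)) ` {a..<a + b})"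
      using e' by (rule bij_betw_trans) (simp add: bij_betw_def inj_on_def)
    then show "bij_betw f P ((\<lambda>i. Tree (Near i)) ` {a..<a + b})"
      by (rule bij_betw_cong[THEN iffD1, rotated]) (use disj in \<open>auto simp: f_def\<close>)
    have "bij_betw ((\<lambda>i. Tree (Far i)) \<circ> (e \<circ> par)) F ((\<lambda>i. Tree (Far i)) ` {..<a})"
      using bij_betw_trans[OF F e] by (rule bij_betw_trans) (simp add: bij_betw_def inj_on_def)
    then show "bij_betw f F ((\<lambda>i. Tree (Far i)) ` {..<a})"
      by (rule bij_betw_cong[THEN iffD1, rotated]) (use disj in \<open>auto simp: f_def\<close>)
    have "f ` X \<subseteq> {Extra}" using disj by (auto simp: f_def)
    moreover have "if ex then \<exists>x. X = {x} else X = {}"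
      using card(3) fin(4) by (cases ex) (auto simp: card_1_singleton_iff)
    ultimately show "bij_betw f X (if ex then {Extra} else {})" by (auto simp: bij_betw_def split: if_splits)
  qed auto
  have fc: "f (c i) = Cyc i" if "i < g" for i
    using that c_notin_T[OF that] by (simp add: f_def T)
  have "bij_betw f (c ` {..<g} \<union> T) (Cyc ` {..<g} \<union> star_tree a b ex)"
  proof (rule bij_betw_combine[OF _ bT])
    show "bij_betw f (c ` {..<g}) (Cyc ` {..<g})"
      unfolding bij_betw_def inj_on_def using fc by (auto simp: image_image)
  qed (auto simp: star_tree_def)
  then have bij: "bij_betw f (verts G) (verts (star_graph g a b ex))" by (simp add: verts_eq)
  have g: "0 < g" "1 < g" using g_ge_3 by auto
  have f_par: "f (par v) = star_par (f v)" if "v \<in> T" for v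
  proof -
    from that consider "v \<in> I" | "v \<in> P" | "v \<in> F" | "v \<in> X" unfolding T by blast
    then show ?thesis
    proof cases
      case 1
      then show ?thesis using par(1)[of v] fc[OF g(1)] by (simp add: f_def)
    next
      case 2
      then show ?thesis using par(1)[of v] fc[OF g(1)] disj by (auto simp: f_def)
    next
      case 3
      moreover have "par v \<in> I" using F 3 by (auto simp: bij_betw_def)
      ultimately show ?thesis using disj by (auto simp: f_def)
    next
      case 4
      then have "f v = Extra" using disj by (auto simp: f_def)
      then show ?thesis using par(2)[OF 4] fc[OF g(2)] by simp
    qed
  qed
  have E: "edges (star_graph g a b ex) = (`) f ` edges G"
  proof -
    have "(`) f ` edges G = (\<lambda>i. {f (c i), f (c (Suc i mod g))}) ` {..<g} \<union> (\<lambda>v. {f v, f (par v)}) ` T"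
      unfolding edges_eq T_def[symmetric] by (simp add: image_Un image_image)
    also have "(\<lambda>i. {f (c i), f (c (Suc i mod g))}) ` {..<g} = (\<lambda>i. {Cyc i, Cyc (Suc i mod g)}) ` {..<g}"
      using g by (intro image_cong) (simp_all add: fc)
    also have "(\<lambda>v. {f v, f (par v)}) ` T = (\<lambda>w. {w, star_par w}) ` f ` T"
      unfolding image_image by (intro image_cong) (simp_all add: f_par)
    also have "f ` T = star_tree a b ex" using bT by (simp add: bij_betw_def)
    finally show ?thesis by simp
  qed
  have "e \<subseteq> verts G" if "e \<in> edges G" for e
  proof -
    from that consider v where "v \<in> T" "e = {v, par v}" | i where "i < g" "e = {c i, c (Suc i mod g)}"
      unfolding edges_eq T_def[symmetric] by blast
    then show ?thesis using T_verts g by cases auto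
  qed
  then show ?thesis by (rule isomorphicI_image[OF bij _ E])
qed

section \<open>Renumbering the cycle\<close>

lemma reindex:
  assumes \<pi>: "bij_betw \<pi> {..<g} {..<g}" and \<rho>: "bij_betw \<rho> {..<g} {..<g}"
    and edge: "\<And>i. i < g \<Longrightarrow> {\<pi> i, \<pi> (Suc i mod g)} = {\<rho> i, Suc (\<rho> i) mod g}"
  shows "rooted_unicycle G g (\<lambda>i. c (\<pi> i)) par h" and "(\<lambda>i. c (\<pi> i)) ` {..<g} = c ` {..<g}"
proof -
  have im: "\<pi> ` {..<g} = {..<g}" "\<rho> ` {..<g} = {..<g}" using \<pi> \<rho> by (simp_all add: bij_betw_def)
  show img: "(\<lambda>i. c (\<pi> i)) ` {..<g} = c ` {..<g}" using im(1) by (metis image_image)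
  \<comment> \<open>\<open>\<rho> i\<close> is the old number of the i-th new cycle edge. For a
    reflection it differs from \<open>\<pi> i\<close>, since edges are then traversed
    backwards.\<close>
  have "{c (\<pi> i), c (\<pi> (Suc i mod g))} = {c (\<rho> i), c (Suc (\<rho> i) mod g)}" if "i < g" for i
    using arg_cong[OF edge[OF that], of "(`) c"] by simp
  then have "(\<lambda>i. {c (\<pi> i), c (\<pi> (Suc i mod g))}) ` {..<g} = (\<lambda>i. {c (\<rho> i), c (Suc (\<rho> i) mod g)}) ` {..<g}"
    by (intro image_cong) auto
  also have "\<dots> = (\<lambda>i. {c i, c (Suc i mod g)}) ` \<rho> ` {..<g}" by (simp add: image_image)
  finally have ed: "(\<lambda>i. {c (\<pi> i), c (\<pi> (Suc i mod g))}) ` {..<g} = (\<lambda>i. {c i, c (Suc i mod g)}) ` {..<g}"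
    by (simp add: im)
  show "rooted_unicycle G g (\<lambda>i. c (\<pi> i)) par h"
  proof
    have "inj_on (c \<circ> \<pi>) {..<g}" using \<pi> inj_c im by (intro comp_inj_on) (simp_all add: bij_betw_def)
    then show "inj_on (\<lambda>i. c (\<pi> i)) {..<g}" by (simp add: comp_def)
  qed (use finite_verts g_ge_3 c_verts par_verts h_par edges_eq in \<open>simp_all add: img ed\<close>)
qed

lemma rotate:
  shows "rooted_unicycle G g (\<lambda>i. c ((i + k) mod g)) par h"
    and "(\<lambda>i. c ((i + k) mod g)) ` {..<g} = c ` {..<g}"
proof -
  have b: "bij_betw (\<lambda>i. (i + k) mod g) {..<g} {..<g}" using g_ge_3 by (intro bij_betw_rotate) simp
  have "{(i + k) mod g, (Suc i mod g + k) mod g} = {(i + k) mod g, Suc ((i + k) mod g) mod g}" for i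
    by (simp add: mod_simps)
  then show "rooted_unicycle G g (\<lambda>i. c ((i + k) mod g)) par h"
    and "(\<lambda>i. c ((i + k) mod g)) ` {..<g} = c ` {..<g}"
    using reindex[OF b b] by blast+
qed

lemma reflect:
  shows "rooted_unicycle G g (\<lambda>i. c ((g - i) mod g)) par h"
    and "(\<lambda>i. c ((g - i) mod g)) ` {..<g} = c ` {..<g}"
proof -
  have b: "bij_betw (\<lambda>i. (g - i) mod g) {..<g} {..<g}"
    by (rule bij_betw_byWitness[where f' = "\<lambda>i. (g - i) mod g"])
      (use g_ge_3 in \<open>auto simp: mod_if\<close>)
  \<comment> \<open>The edge between the positions -i and -(i + 1) modulo g is the old edge number g
    - 1 - i.\<close>
  have b': "bij_betw (\<lambda>i. g - Suc i) {..<g} {..<g}"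
    by (rule bij_betw_byWitness[where f' = "\<lambda>i. g - Suc i"]) auto
  have "{(g - i) mod g, (g - Suc i mod g) mod g} = {g - Suc i, Suc (g - Suc i) mod g}" if "i < g" for i
  proof -
    have "(g - Suc i mod g) mod g = g - Suc i" using that by (auto simp: Suc_mod_eq)
    moreover have "Suc (g - Suc i) = g - i" using that by simp
    ultimately show ?thesis by (simp add: insert_commute)
  qed
  then show "rooted_unicycle G g (\<lambda>i. c ((g - i) mod g)) par h"
    and "(\<lambda>i. c ((g - i) mod g)) ` {..<g} = c ` {..<g}"
    using reindex[OF b b'] by blast+
qed

text \<open>A rotation brings \<open>r\<close> to position 0; if \<open>q\<close> precedes
  \<open>r\<close>, a reflection fixing position 0 follows.\<close>

lemma renumber:
  assumes r: "r < g" and q: "q < g" and adj: "q = Suc r mod g \<or> r = Suc q mod g"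
  obtains c' where "rooted_unicycle G g c' par h" "c' ` {..<g} = c ` {..<g}" "c' 0 = c r" "c' 1 = c q"
  using adj
proof
  assume "q = Suc r mod g"
  then show thesis using that[of "\<lambda>i. c ((i + r) mod g)"] rotate[of r] r by simp
next
  assume rq: "r = Suc q mod g"
  interpret R: rooted_unicycle G g "\<lambda>i. c ((i + r) mod g)" par h by (rule rotate)
  have pred: "(g - 1) mod g = g - 1" using g_ge_3 by simp
  \<comment> \<open>After both moves, position 1 holds the old predecessor of \<open>r\<close>,
    which is \<open>q\<close>.\<close>
  then have "((g - 1) mod g + r) mod g = (g - 1 + Suc q) mod g" unfolding rq by (simp only: mod_add_right_eq)
  also have "g - 1 + Suc q = q + g" using g_ge_3 by simp
  finally have "((g - 1) mod g + r) mod g = q" using q by simp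
  then show thesis
    using that[OF R.reflect(1)] R.reflect(2) rotate(2)[of r] r by simp
qed

section \<open>Structure of the trees when no bridge cuts off more than two vertices\<close>

lemma root_image_lt: "i \<in> root ` T \<Longrightarrow> i < g"
  using T_verts by auto

definition inner :: "'a set" where
  "inner = {z \<in> T. sub z = 2}"

definition hanging :: "'a set" where
  "hanging = {z \<in> T. par z \<in> T}"

lemma par_root: "z \<in> T \<Longrightarrow> z \<notin> hanging \<Longrightarrow> par z = c (root z)"
proof -
  assume z: "z \<in> T" "z \<notin> hanging"
  then have "par z \<notin> T" by (simp add: hanging_def)
  then obtain i where "i < g" "par z = c i"
    using verts_cases[OF par_in_verts[OF z(1)]] by blast
  then show ?thesis using root_par[OF z(1)] by simp
qed

context
  assumes le2: "\<forall>z\<in>T. sub z \<le> 2"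
begin

lemma T_split: "T = inner \<union> leaves" "inner \<inter> leaves = {}"
proof -
  have "sub z = 1 \<or> sub z = 2" if "z \<in> T" for z
    using bspec[OF le2 that] sub_bounds(1)[OF that] by linarith
  then show "T = inner \<union> leaves" "inner \<inter> leaves = {}" by (auto simp: inner_def leaves_def)
qed

text \<open>\<open>sub\<close> grows strictly towards the parent and stays at most 2 on
  \<open>T\<close>, so a tree vertex and its parent in \<open>T\<close> must have the values 1 and
  2.\<close>

lemma hanging_leaves: "hanging \<subseteq> leaves" and par_hanging: "z \<in> hanging \<Longrightarrow> par z \<in> inner"
proof -
  have *: "sub z = 1 \<and> sub (par z) = 2" if "z \<in> T" "par z \<in> T" for z
    using sub_less_sub_par[OF that(1)] sub_bounds(1)[OF that(1)] le2 that(2) by force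
  then show "hanging \<subseteq> leaves" "z \<in> hanging \<Longrightarrow> par z \<in> inner"
    by (auto simp: hanging_def leaves_def inner_def)
qed

lemma inner_child:
  assumes "z \<in> inner"
  obtains y where "y \<in> hanging" "par y = z"
proof -
  have z: "z \<in> T" "sub z = 2" using assms by (auto simp: inner_def)
  then have "{v \<in> verts G. anc z v} \<noteq> {z}" unfolding sub_def by force
  moreover have "z \<in> {v \<in> verts G. anc z v}" using z T_verts by simp
  ultimately obtain v where "anc z v" "z \<noteq> v" by blast
  then obtain y where "y \<in> T" "par y = z" using anc_child by metis
  then show thesis using that z by (simp add: hanging_def)
qed

text \<open>An inner vertex has exactly one descendant besides itself; a second child would raise
  \<open>sub\<close> to 3.\<close>

lemma bij_hanging: "bij_betw par hanging inner"
  unfolding bij_betw_def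
proof
  show "par ` hanging = inner" using par_hanging inner_child by blast
  show "inj_on par hanging"
  proof (rule inj_onI, rule ccontr)
    fix x y assume xy: "x \<in> hanging" "y \<in> hanging" "par x = par y" "x \<noteq> y"
    then have T: "x \<in> T" "y \<in> T" "par x \<in> T" by (auto simp: hanging_def)
    have "{par x, x, y} \<subseteq> {v \<in> verts G. anc (par x) v}"
      using T anc_T[of x "par x"] anc_T[of y "par x"] xy T_verts by auto
    then have "card {par x, x, y} \<le> sub (par x)"
      unfolding sub_def using finite_verts by (intro card_mono) auto
    moreover have "card {par x, x, y} = 3" using xy T par_neq[of x] par_neq[of y] by simp
    ultimately show False using le2 T by force
  qed
qed

text \<open>With N tree vertices and L leaves, there are N - L inner vertices and 2 L - N leaves
  attached directly to the cycle, which fixes the parameters of the star.\<close>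

lemma cards_equality_case:
  "card inner + card leaves = card T" "card hanging = card inner"
  "card (leaves - hanging) + card inner = card leaves"
proof -
  have fin: "finite inner" "finite leaves" "finite hanging"
    by (simp_all add: inner_def leaves_def hanging_def)
  show "card inner + card leaves = card T"
    using T_split fin by (metis card_Un_disjoint)
  show h: "card hanging = card inner" using bij_hanging by (rule bij_betw_same_card)
  show "card (leaves - hanging) + card inner = card leaves"
    using hanging_leaves fin h card_mono[OF fin(2) hanging_leaves] by (simp add: card_Diff_subset)
qed

lemma isomorphic_one_root:
  assumes r: "root ` T = {r}"
  shows "isomorphic G (star_graph g (card T - card leaves) (2 * card leaves - card T) False)"
proof -
  have rg: "r < g" using root_image_lt r by simp
  have "Suc r mod g < g" using rg by simp
  then obtain c' where c': "rooted_unicycle G g c' par h" "c' ` {..<g} = c ` {..<g}" "c' 0 = c r"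
    "c' 1 = c (Suc r mod g)"
    by (rule renumber[OF rg _ disjI1[OF refl]])
  interpret R: rooted_unicycle G g c' par h by (rule c')
  have T: "R.T = T" by (simp add: R.T_def T_def c')
  show ?thesis
  proof (rule R.isomorphic_star_graph[where I = inner and P = "leaves - hanging" and F = hanging and X = "{}"])
    show "R.T = inner \<union> (leaves - hanging) \<union> hanging \<union> {}"
      unfolding T using T_split(1) hanging_leaves by blast
    show "par v = c' 0" if "v \<in> inner \<union> (leaves - hanging)" for v
    proof -
      have v: "v \<in> T" "v \<notin> hanging" using that T_split hanging_leaves by blast+
      then have "root v \<in> root ` T" by simp
      then have "root v = r" using r by simp
      then show ?thesis using par_root[OF v] c'(3) by simp
    qed
    show "bij_betw par hanging inner" by (rule bij_hanging)
  qed (use T_split hanging_leaves cards_equality_case in auto)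
qed

text \<open>The value of the root sum forces one of the two trees to be a single vertex and the two
  roots to be adjacent. The single vertex becomes \<open>Extra\<close>.\<close>

lemma isomorphic_two_roots:
  assumes m: "card (root ` T) = 2" and rs: "root_sum = 2 * (card T - 1)"
  shows "isomorphic G (star_graph g (card T - card leaves) (2 * card leaves - card T - 1) True)"
proof -
  obtain p q where pq: "root ` T = {p, q}" "p \<noteq> q" using m by (auto simp: card_2_iff)
  define A where "A i = {v \<in> T. root v = i}" for i
  have lt: "p < g" "q < g" using root_image_lt pq(1) by simp_all
  have TA: "T = A p \<union> A q" "A p \<inter> A q = {}" using pq by (auto simp: A_def)
  have fin: "finite (A i)" for i by (simp add: A_def)
  have N: "card T = card (A p) + card (A q)"
    using card_Un_disjoint[OF fin fin TA(2)] TA(1) by simp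
  have "p \<in> root ` T" "q \<in> root ` T" using pq(1) by simp_all
  then have ne: "A p \<noteq> {}" "A q \<noteq> {}" unfolding A_def by auto
  have sum_T: "sum f T = sum f (A p) + sum f (A q)" for f :: "'a \<Rightarrow> nat"
    using sum.union_disjoint[OF fin fin TA(2)] TA(1) by simp
  have row: "(\<Sum>v\<in>T. cdist g i (root v)) = card (A p) * cdist g i p + card (A q) * cdist g i q" for i
    unfolding sum_T by (simp add: A_def)
  have "root_sum = card (A p) * (card (A q) * cdist g p q) + card (A q) * (card (A p) * cdist g q p)"
    unfolding root_sum_def row unfolding sum_T by (simp add: A_def)
  also have "\<dots> = 2 * (card (A p) * card (A q) * cdist g p q)" by (simp add: cdist_sym[of g q p])
  finally have eq: "card (A p) * card (A q) * cdist g p q = card (A p) + card (A q) - 1"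
    using rs N by simp
  have pos: "1 \<le> card (A p)" "1 \<le> card (A q)" "1 \<le> cdist g p q"
    using ne fin cdist_pos[OF lt pq(2)] by (simp_all add: Suc_le_eq card_gt_0_iff)
  obtain x y where xy: "card (A p) = Suc x" "card (A q) = Suc y" using pos by (metis Suc_le_D One_nat_def)
  have "(Suc x * Suc y) * 1 \<le> (Suc x * Suc y) * cdist g p q" using pos by (intro mult_left_mono) auto
  \<comment> \<open>The equation reads (x + 1) (y + 1) d = x + y + 1 with d >= 1, which leaves only
    x y = 0 and d = 1.\<close>
  then have "x * y = 0" using eq xy by simp
  then have one: "card (A p) = 1 \<or> card (A q) = 1" using xy by auto
  then have d: "cdist g p q = 1" using eq pos by auto
  \<comment> \<open>\<open>s\<close> is chosen as the root carrying the single vertex, and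
    \<open>r\<close> as the root of all others.\<close>
  obtain r s where rs: "r < g" "s < g" "r \<noteq> s" "root ` T = {r, s}" "card (A s) = 1"
    "s = Suc r mod g \<or> r = Suc s mod g"
  proof (cases "card (A q) = 1")
    case True
    then show thesis using that[of p q] lt pq cdist_1[OF lt d] by blast
  next
    case False
    then show thesis using that[of q p] lt pq one cdist_1[OF lt d] by blast
  qed
  obtain x where x: "A s = {x}" using rs(5) card_1_singletonE by blast
  have xT: "x \<in> T" "root x = s" using x by (auto simp: A_def)
  have root_x: "v = x" if "v \<in> T" "root v = s" for v using x that by (auto simp: A_def)
  \<comment> \<open>A parent or child of \<open>x\<close> in \<open>T\<close> would have the same
    root \<open>s\<close> and hence be \<open>x\<close> itself.\<close>
  have xh: "x \<notin> hanging"
    using root_x[of "par x"] xT root_par[OF xT(1)] par_neq[OF xT(1)] by (auto simp: hanging_def)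
  have xi: "x \<notin> inner"
  proof
    assume "x \<in> inner"
    then obtain y where y: "y \<in> hanging" "par y = x" by (rule inner_child)
    then have "y \<in> T" "root y = s" using xT root_par[of y] by (auto simp: hanging_def)
    then show False using root_x[of y] y par_neq[of y] by simp
  qed
  then have xl: "x \<in> leaves - hanging" using xT xh T_split by blast
  obtain c' where c': "rooted_unicycle G g c' par h" "c' ` {..<g} = c ` {..<g}" "c' 0 = c r" "c' 1 = c s"
    by (rule renumber[OF rs(1,2,6)])
  interpret R: rooted_unicycle G g c' par h by (rule c')
  have T: "R.T = T" by (simp add: R.T_def T_def c')
  show ?thesis
  proof (rule R.isomorphic_star_graph[where I = inner and P = "leaves - hanging - {x}" and F = hanging and X = "{x}"])
    show "R.T = inner \<union> (leaves - hanging - {x}) \<union> hanging \<union> {x}"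
      unfolding T using T_split(1) hanging_leaves xT by blast
    show "par v = c' 0" if "v \<in> inner \<union> (leaves - hanging - {x})" for v
    proof -
      have v: "v \<in> T" "v \<notin> hanging" "v \<noteq> x" using that T_split hanging_leaves xi by blast+
      then have "root v \<in> root ` T" by simp
      then have "root v = r" using rs(4) root_x[OF v(1)] v(3) by auto
      then show ?thesis using par_root[OF v(1,2)] c'(3) by simp
    qed
    show "par v = c' 1" if "v \<in> {x}" for v using that par_root xT xh c'(4) by simp
    show "bij_betw par hanging inner" by (rule bij_hanging)
    have "finite leaves" by (simp add: leaves_def)
    then show "card (leaves - hanging - {x}) = 2 * card leaves - card T - 1"
      using cards_equality_case xl by simp
  qed (use T_split hanging_leaves cards_equality_case xh xi in auto)
qed

end

end

section \<open>Comparison with the extremal graph\<close>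

theorem theorem3p8:
  fixes G :: "'a ugraph" and n g \<beta> :: nat
  assumes "unicyclic G"
    and "card (verts G) = n"
    and "girth G = g"
    and "matching_number G = \<beta>"
    and "real \<beta> \<ge> 3 * real g / 2"
  shows "wiener G \<ge> wiener (G_star n g \<beta>) \<and>
         (wiener G = wiener (G_star n g \<beta>) \<longleftrightarrow> isomorphic G (G_star n g \<beta>))"
proof -
  obtain c par h where "rooted_unicycle G g c par h"
    using unicyclic_rooted[OF assms(1)] assms(3) by metis
  then interpret R: rooted_unicycle G g c par h .
  have "real (3 * g) \<le> real (2 * \<beta>)" using assms(5) by simp
  then have \<beta>: "3 * g \<le> 2 * \<beta>" by (simp only: of_nat_le_iff)
  have g: "3 \<le> g" by (rule R.g_ge_3)
  obtain M where "matching G M" "card M = \<beta>" using R.ex_maximum_matching assms(4) by blast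
  \<comment> \<open>Together with the hypothesis on the girth, this makes the natural-number
    subtractions in the parameters genuine.\<close>
  then have \<beta>n: "2 * \<beta> \<le> n" using R.card_leaves_le(1) assms(2) by blast
  let ?ex = "even g"
  define a where "a = (if odd g then \<beta> - (g + 1) div 2 else \<beta> - g div 2 - 1)"
  define b where "b = n - 2 * \<beta> + 1"
  define N where "N = 2 * a + b + of_bool ?ex"
  define L where "L = a + b + of_bool ?ex"
  have star: "G_star n g \<beta> = star_graph g a b ?ex"
    using G_star_eq[OF g] by (simp add: a_def b_def)
  have size: "N + g = n" "2 * L + g + 2 * \<beta> = 2 * n + (if odd g then 1 else 2)"
    using \<beta> \<beta>n g by (auto simp: N_def L_def a_def b_def elim!: oddE evenE)
  have card_T: "card R.T = N" using R.card_verts assms(2) size(1) by simp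
  \<comment> \<open>The parameters are rewritten in the form in which the equality case delivers
    them.\<close>
  have ab: "a = N - L" "b = 2 * L - N - of_bool ?ex" by (simp_all add: N_def L_def)
  obtain B where B: "B + L * (N + g - 3) = 2 * (N + g - 2) * N"
    and W: "2 * wiener (star_graph g a b ?ex) = 2 * B + (\<Sum>i<g. \<Sum>j<g. cdist g i j)
      + 2 * N * (\<Sum>j<g. cdist g 0 j) + (if ?ex then 2 * (N - 1) else 0)"
    using star_graph_wiener[OF g, of a b ?ex] unfolding N_def L_def by blast
  note bound = R.wiener_bound[of "wiener (star_graph g a b ?ex)" B "if ?ex then 2 * (N - 1) else 0" L,
      unfolded card_T assms(2,4), OF \<beta> W B[unfolded size(1)]]
  have le: "wiener (star_graph g a b ?ex) \<le> wiener G"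
    using size(2) by (intro bound(1)) auto
  have "isomorphic G (star_graph g a b ?ex)" if "wiener G = wiener (star_graph g a b ?ex)"
  proof -
    have *: "(\<forall>z\<in>R.T. R.sub z \<le> 2) \<and> card R.leaves = L \<and> R.root_sum = (if ?ex then 2 * (N - 1) else 0)
        \<and> card (R.root ` R.T) = (if odd g then 1 else 2)"
      using size(2) by (intro bound(2) that) auto
    show ?thesis
    proof (cases "odd g")
      case True
      then obtain r where r: "R.root ` R.T = {r}" using * card_1_singletonE by auto
      show ?thesis
        using R.isomorphic_one_root[OF _ r] * True ab by (simp add: card_T)
    next
      case False
      then show ?thesis
        using R.isomorphic_two_roots * ab by (simp add: card_T)
    qed
  qed
  then show ?thesis using le isomorphic_wiener unfolding star by metis
qed

end
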